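(* Let $d\ge2$, suppose that the edge-weight distribution satisfies assumption A or assumption B, and let $\mu$ be a geodesic measure on $\widetilde\Omega$ (all as defined in the context). Let $S=\sup\{x\ge0:\mu(t_e\ge x)>0\}\in(0,\infty]$. Let $e_0\in\mathcal{E}^d$ and $\lambda\in[0,S)$. For any $r>0$ there exists $s>0$ such that if $A$ is an $e_0$-approximable event (for $\mu$) with $\mu(A)\ge r$, then $$\mu(A,\,t_{e_0}\ge\lambda)\ge s.$$
   Context: **First-passage percolation.** Let $d\ge 2$, let $\mathcal{E}^d$ be the set of (undirected) nearest-neighbor edges of $\mathbb{Z}^d$ and $\vec{\mathcal{E}}^d=\{\langle x,y\rangle:\{x,y\}\in\mathcal{E}^d\}$ the set of directed edges. Let $(t_e)_{e\in\mathcal{E}^d}$ be nonnegative random variables (edge-weights), the coordinate variables on $\Omega=[0,\infty)^{\mathcal{E}^d}$ with the product Borel sigma-algebra and a probability measure $\mathbb{P}$. A finite lattice path from $x$ to $y$ is a sequence $x=v_0,e_0,v_1,\dots,v_{n-1},e_{n-1},v_n=y$ in which $e_i$ has endpoints $v_i$ and $v_{i+1}$; its passage time is $T(\Gamma)=\sum_{i=0}^{n-1}t_{e_i}$. For $x,y\in\mathbb{Z}^d$, $T(x,y)=\inf_{\Gamma:x\to y}T(\Gamma)$. For $x,y\in\mathbb{R}^d$ set $T(x,y)=T(\lfloor x\rfloor,\lfloor y\rfloor)$ (coordinatewise floor), and for $A,B\subset\mathbb{R}^d$ set $T(A,B)=\inf_{x\in A,y\in B}T(x,y)$. A geodesic from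 $x$ to a set $B$ is a path attaining the passage time $T(x,B)$. Let $g(x)=\lim_{n\to\infty}T(0,nx)/n$ (limit in probability); the limit shape is $\mathcal{B}=\{x\in\mathbb{R}^d:g(x)\le 1\}$. **Assumption A.** The variables $(t_e)$ are i.i.d. with continuous common distribution, and if $e_1,\dots,e_{2d}$ are the $2d$ edges incident to the origin, $\mathbb{E}\big[(\min_{i=1,\dots,2d}t_{e_i})^d\big]<\infty$. **Assumption B.** (a) The distribution of $(t_e)$ is ergodic with respect to translations of $\mathbb{Z}^d$; (b) it has all the symmetries of $\mathbb{Z}^d$; (c) $\mathbb{E}t_e^{d+\epsilon}<\infty$ for some $\epsilon>0$; (d) the limit shape $\mathcal{B}$ is bounded. Furthermore it has unique passage times: for any two paths $\gamma,\gamma'$ with distinct edge sets, $\mathbb{P}(T(\gamma)=T(\gamma'))=0$. Last, it has the upward finite energy property: for each $\lambda>0$ with $\mathbb{P}(t_e\ge\lambda)>0$, one has $\mathbb{P}(t_e\ge\lambda\mid(t_f)_{f\ne e})>0$ a.s. **Geodesic measure $\mu$.** Under A or B, $\mathcal{B}$ is convex and compact with nonempty interior containing $0$. Fix a supporting hyperplane $H$ for $\mathcal{B}$ at a point $z_0\in\mathcal{B}$ (that is, $z_0\in H$ and $\mathcal{B}$ intersects exactly one component of $\mathbb{R}^d\setminus H$), and let $\rho\in\mathbb{R}^d$ be the unique vector with $H=\{z:z\cdot\rho=1\}$. For $\alpha\in\mathbb{R}$ let $H_\rho(\alpha)=\{z\in\mathbb{R}^d:z\cdot\rho=\alpha\}$.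 Let $\Omega_1=[0,\infty)^{\mathcal{E}^d}$, $\Omega_2=\mathbb{R}^{\mathbb{Z}^d\times\mathbb{Z}^d}$, $\Omega_3=\{0,1\}^{\vec{\mathcal{E}}^d}$ and $\widetilde\Omega=\Omega_1\times\Omega_2\times\Omega_3$ with the product Borel sigma-algebra; elements are written $((t_e),B,\eta)$. For a weight configuration $\omega=(t_e)$ let $B_\alpha(x,y)(\omega)=T(x,H_\rho(\alpha))-T(y,H_\rho(\alpha))$ and let $\eta_\alpha(\langle x,y\rangle)(\omega)=1$ if $\{x,y\}$ is in a geodesic from $x$ to $H_\rho(\alpha)$ and $0$ otherwise. Let $\Phi_\alpha(\omega)=((t_e)(\omega),B_\alpha(\omega),\eta_\alpha(\omega))\in\widetilde\Omega$, $\mu_\alpha=\mathbb{P}\circ\Phi_\alpha^{-1}$, and $\mu_n^*=\frac1n\int_0^n\mu_\alpha\,d\alpha$. The sequence $(\mu_n^* )$ is tight; a geodesic measure $\mu$ is any subsequential weak limit of $(\mu_n^* )$. **Events.** Events in the Borel sigma-algebra of $\Omega_1\times\Omega_3$ are viewed as events in $\widetilde\Omega$ by leaving the $\Omega_2$ coordinate free. *Graph-cylinder event.* A Borel measurable $A\subset\Omega_1\times\Omega_3$ is a graph-cylinder event if it is a finite union of events of the form $U\times V$, where $U\subset\Omega_1$ is Borel measurable and $V=\{\eta(e_1)=a_1,\dots,\eta(e_n)=a_n\}\subset\Omega_3$ for fixed directed edges $e_i\in\vec{\mathcal{E}}^d$ and $a_i\in\{0,1\}$. *$e_0$-approximable event.*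 Given $e_0\in\mathcal{E}^d$, a Borel measurable $A\subset\Omega_1\times\Omega_3$ is $e_0$-approximable (for $\mu$) if there exists a sequence $(A_n)$ of graph-cylinder events such that $\mu(A_n\Delta A)\to0$ as $n\to\infty$ and, for each $n$, there exists $\alpha_0=\alpha_0(n,e_0,A)$ such that if $\alpha\ge\alpha_0$ and $(t_e)\in\Omega_1$, then $$((t_e),\eta_\alpha((t_e)))\in A_n\ \text{ implies }\ ((t_e'),\eta_\alpha((t_e')))\in A_n$$ whenever $(t_e')\in\Omega_1$ satisfies $t'_{e_0}\ge t_{e_0}$ and $t'_e=t_e$ for all $e\ne e_0$. *)

theory Defs
  imports "HOL-Probability.Probability"
begin

text \<open>
  The dimension $d$ is \<open>CARD('d)\<close> for a finite index type \<open>'d\<close>.  An undirected edge is the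
  two-element set of its endpoints, a directed edge is an ordered pair.
\<close>

type_synonym 'd vertex = "int ^ 'd"
type_synonym 'd edge = "'d vertex set"
type_synonym 'd dedge = "'d vertex \<times> 'd vertex"
type_synonym 'd weights = "'d edge \<Rightarrow> real"
type_synonym 'd config =
  "'d weights \<times> ('d vertex \<times> 'd vertex \<Rightarrow> real) \<times> ('d dedge \<Rightarrow> bool)"

definition adjacent :: "('d::finite) vertex \<Rightarrow> 'd vertex \<Rightarrow> bool" where
  "adjacent x y \<longleftrightarrow> (\<Sum>i\<in>UNIV. \<bar>x $ i - y $ i\<bar>) = 1"

definition edges :: "('d::finite) edge set" where
  "edges = {{x, y} | x y. adjacent x y}"

definition dedges :: "('d::finite) dedge set" where
  "dedges = {(x, y). {x, y} \<in> edges}"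

text \<open>
  Since two adjacent vertices are joined by exactly one edge, a finite lattice path is given by the
  nonempty list of its successive vertices; repetitions are allowed, and so is the path with one
  vertex and no edge.
\<close>

definition lattice_path :: "('d::finite) vertex list \<Rightarrow> bool" where
  "lattice_path p \<longleftrightarrow> p \<noteq> [] \<and> (\<forall>i. Suc i < length p \<longrightarrow> {p ! i, p ! Suc i} \<in> edges)"

definition path_between :: "('d::finite) vertex \<Rightarrow> 'd vertex \<Rightarrow> 'd vertex list \<Rightarrow> bool" where
  "path_between x y p \<longleftrightarrow> lattice_path p \<and> hd p = x \<and> last p = y"

definition path_edges :: "('d::finite) vertex list \<Rightarrow> 'd edge set" where
  "path_edges p = {{p ! i, p ! Suc i} | i. Suc i < length p}"

definition path_time :: "('d::finite) weights \<Rightarrow> 'd vertex list \<Rightarrow> real" where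
  "path_time t p = (\<Sum>i<length p - 1. t {p ! i, p ! Suc i})"

definition lattice_time :: "('d::finite) weights \<Rightarrow> 'd vertex \<Rightarrow> 'd vertex \<Rightarrow> real" where
  "lattice_time t x y = (INF p\<in>{p. path_between x y p}. path_time t p)"

definition floor_vec :: "real ^ 'd \<Rightarrow> ('d::finite) vertex" where
  "floor_vec x = (\<chi> i. \<lfloor>x $ i\<rfloor>)"

definition real_vec :: "('d::finite) vertex \<Rightarrow> real ^ 'd" where
  "real_vec v = (\<chi> i. real_of_int (v $ i))"

definition point_time :: "('d::finite) weights \<Rightarrow> real ^ 'd \<Rightarrow> real ^ 'd \<Rightarrow> real" where
  "point_time t x y = lattice_time t (floor_vec x) (floor_vec y)"

definition set_time :: "('d::finite) weights \<Rightarrow> (real ^ 'd) set \<Rightarrow> (real ^ 'd) set \<Rightarrow> real" where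
  "set_time t A B = (INF (x, y)\<in>A \<times> B. point_time t x y)"

definition geodesic_to ::
  "('d::finite) weights \<Rightarrow> 'd vertex \<Rightarrow> (real ^ 'd) set \<Rightarrow> 'd vertex list \<Rightarrow> bool" where
  "geodesic_to t x B p \<longleftrightarrow>
     (\<exists>y\<in>B. path_between x (floor_vec y) p) \<and> path_time t p = set_time t {real_vec x} B"

text \<open>
  Functions on \<open>edges\<close> and \<open>dedges\<close> are extensional.  In \<open>direction_space\<close> the values 1 and 0 are
  rendered as \<open>True\<close> and \<open>False\<close>.  All index sets are countable, so the product sigma-algebra of
  \<open>config_space\<close> is the Borel sigma-algebra of \<open>config_topology\<close>.
\<close>

definition weight_space :: "('d::finite) weights measure" where
  "weight_space = PiM edges (\<lambda>_. restrict_space borel {0..})"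

definition busemann_space :: "(('d::finite) vertex \<times> 'd vertex \<Rightarrow> real) measure" where
  "busemann_space = PiM UNIV (\<lambda>_. borel)"

definition direction_space :: "(('d::finite) dedge \<Rightarrow> bool) measure" where
  "direction_space = PiM dedges (\<lambda>_. count_space UNIV)"

definition config_space :: "('d::finite) config measure" where
  "config_space = weight_space \<Otimes>\<^sub>M (busemann_space \<Otimes>\<^sub>M direction_space)"

definition config_topology :: "('d::finite) config topology" where
  "config_topology =
     prod_topology (product_topology (\<lambda>_. top_of_set {0..}) edges)
       (prod_topology (product_topology (\<lambda>_. euclideanreal) UNIV)
         (product_topology (\<lambda>_. discrete_topology UNIV) dedges))"

definition converges_in_prob :: "'a measure \<Rightarrow> (nat \<Rightarrow> 'a \<Rightarrow> real) \<Rightarrow> real \<Rightarrow> bool" where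
  "converges_in_prob P X l \<longleftrightarrow>
     (\<forall>\<epsilon>>0. (\<lambda>n. measure P {\<omega> \<in> space P. \<bar>X n \<omega> - l\<bar> > \<epsilon>}) \<longlonglongrightarrow> 0)"

text \<open>
  Under either assumption the limit in probability exists and is unique.
\<close>

definition time_constant :: "('d::finite) weights measure \<Rightarrow> real ^ 'd \<Rightarrow> real" where
  "time_constant P x =
     (THE l. converges_in_prob P (\<lambda>n t. point_time t 0 (real n *\<^sub>R x) / real n) l)"

definition limit_shape :: "('d::finite) weights measure \<Rightarrow> (real ^ 'd) set" where
  "limit_shape P = {x. time_constant P x \<le> 1}"

definition assumption_A :: "('d::finite) weights measure \<Rightarrow> bool" where
  "assumption_A P \<longleftrightarrow>
     prob_space.indep_vars P (\<lambda>_. borel) (\<lambda>e t. t e) edges \<and>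
     (\<forall>e\<in>edges. \<forall>f\<in>edges. distr P borel (\<lambda>t. t e) = distr P borel (\<lambda>t. t f)) \<and>
     (\<forall>e\<in>edges. continuous_on UNIV (cdf (distr P borel (\<lambda>t. t e)))) \<and>
     integrable P (\<lambda>t. (Min (t ` {e \<in> edges. 0 \<in> e})) ^ CARD('d))"

definition relabel :: "('d vertex \<Rightarrow> 'd vertex) \<Rightarrow> ('d::finite) weights \<Rightarrow> 'd weights" where
  "relabel \<phi> t = (\<lambda>e\<in>edges. t (\<phi> ` e))"

definition ergodic :: "('d::finite) weights measure \<Rightarrow> bool" where
  "ergodic P \<longleftrightarrow>
     (\<forall>a. distr P weight_space (relabel (\<lambda>x. x + a)) = P) \<and>
     (\<forall>E\<in>sets P. (\<forall>a. relabel (\<lambda>x. x + a) -` E \<inter> space P = E) \<longrightarrow> measure P E \<in> {0, 1})"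

text \<open>
  The adjacency-preserving bijections of the lattice are exactly the signed coordinate permutations
  composed with translations.
\<close>

definition lattice_symmetry :: "(('d::finite) vertex \<Rightarrow> 'd vertex) \<Rightarrow> bool" where
  "lattice_symmetry \<phi> \<longleftrightarrow> bij \<phi> \<and> (\<forall>x y. adjacent (\<phi> x) (\<phi> y) \<longleftrightarrow> adjacent x y)"

definition has_lattice_symmetries :: "('d::finite) weights measure \<Rightarrow> bool" where
  "has_lattice_symmetries P \<longleftrightarrow>
     (\<forall>\<phi>. lattice_symmetry \<phi> \<longrightarrow> distr P weight_space (relabel \<phi>) = P)"

definition unique_passage_times :: "('d::finite) weights measure \<Rightarrow> bool" where
  "unique_passage_times P \<longleftrightarrow>
     (\<forall>p q. lattice_path p \<and> lattice_path q \<and> path_edges p \<noteq> path_edges q \<longrightarrow>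
        measure P {t \<in> space P. path_time t p = path_time t q} = 0)"

definition others_algebra :: "('d::finite) weights measure \<Rightarrow> 'd edge \<Rightarrow> 'd weights measure" where
  "others_algebra P e =
     vimage_algebra (space P) (\<lambda>t. restrict t (edges - {e}))
       (PiM (edges - {e}) (\<lambda>_. restrict_space borel {0..}))"

definition upward_finite_energy :: "('d::finite) weights measure \<Rightarrow> bool" where
  "upward_finite_energy P \<longleftrightarrow>
     (\<forall>e\<in>edges. \<forall>\<kappa>>0. measure P {t \<in> space P. t e \<ge> \<kappa>} > 0 \<longrightarrow>
        (AE t in P. real_cond_exp P (others_algebra P e)
                      (indicator {t \<in> space P. t e \<ge> \<kappa>}) t > 0))"

definition assumption_B :: "('d::finite) weights measure \<Rightarrow> bool" where
  "assumption_B P \<longleftrightarrow>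
     ergodic P \<and>
     has_lattice_symmetries P \<and>
     (\<exists>\<epsilon>>0. \<forall>e\<in>edges. integrable P (\<lambda>t. t e powr (real CARD('d) + \<epsilon>))) \<and>
     bounded (limit_shape P) \<and>
     unique_passage_times P \<and>
     upward_finite_energy P"

definition supporting_hyperplane :: "(real ^ 'd) set \<Rightarrow> (real ^ 'd) set \<Rightarrow> real ^ 'd \<Rightarrow> bool" where
  "supporting_hyperplane K H z\<^sub>0 \<longleftrightarrow>
     (\<exists>a b. a \<noteq> 0 \<and> H = {z. a \<bullet> z = b}) \<and> z\<^sub>0 \<in> K \<and> z\<^sub>0 \<in> H \<and>
     (\<exists>!C. C \<in> components (- H) \<and> K \<inter> C \<noteq> {})"

definition hyperplane :: "real ^ 'd \<Rightarrow> real \<Rightarrow> (real ^ 'd) set" where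
  "hyperplane \<rho> \<alpha> = {z. z \<bullet> \<rho> = \<alpha>}"

definition busemann ::
  "real ^ 'd \<Rightarrow> real \<Rightarrow> ('d::finite) weights \<Rightarrow> 'd vertex \<times> 'd vertex \<Rightarrow> real" where
  "busemann \<rho> \<alpha> t = (\<lambda>(x, y).
     set_time t {real_vec x} (hyperplane \<rho> \<alpha>) - set_time t {real_vec y} (hyperplane \<rho> \<alpha>))"

definition direction :: "real ^ 'd \<Rightarrow> real \<Rightarrow> ('d::finite) weights \<Rightarrow> 'd dedge \<Rightarrow> bool" where
  "direction \<rho> \<alpha> t = (\<lambda>(x, y)\<in>dedges.
     \<exists>p. geodesic_to t x (hyperplane \<rho> \<alpha>) p \<and> {x, y} \<in> path_edges p)"

definition config_map :: "real ^ 'd \<Rightarrow> real \<Rightarrow> ('d::finite) weights \<Rightarrow> 'd config" where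
  "config_map \<rho> \<alpha> t = (t, busemann \<rho> \<alpha> t, direction \<rho> \<alpha> t)"

definition mu_alpha ::
  "('d::finite) weights measure \<Rightarrow> real ^ 'd \<Rightarrow> real \<Rightarrow> 'd config measure" where
  "mu_alpha P \<rho> \<alpha> = distr P config_space (config_map \<rho> \<alpha>)"

definition mu_star ::
  "('d::finite) weights measure \<Rightarrow> real ^ 'd \<Rightarrow> nat \<Rightarrow> 'd config measure" where
  "mu_star P \<rho> n = measure_of (space config_space) (sets config_space)
     (\<lambda>E. (\<integral>\<^sup>+\<alpha>\<in>{0..real n}. emeasure (mu_alpha P \<rho> \<alpha>) E \<partial>lborel) / of_nat n)"

definition converges_weakly ::
  "'a topology \<Rightarrow> (nat \<Rightarrow> 'a measure) \<Rightarrow> 'a measure \<Rightarrow> bool" where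
  "converges_weakly X M N \<longleftrightarrow>
     (\<forall>f. continuous_map X euclideanreal f \<and> bounded (f ` topspace X) \<longrightarrow>
        (\<lambda>n. \<integral>x. f x \<partial>M n) \<longlonglongrightarrow> (\<integral>x. f x \<partial>N))"

definition geodesic_measure ::
  "('d::finite) weights measure \<Rightarrow> real ^ 'd \<Rightarrow> 'd config measure \<Rightarrow> bool" where
  "geodesic_measure P \<rho> \<mu> \<longleftrightarrow>
     prob_space \<mu> \<and> sets \<mu> = sets config_space \<and>
     (\<exists>k. strict_mono k \<and> converges_weakly config_topology (\<lambda>n. mu_star P \<rho> (k n)) \<mu>)"

definition graph_cylinder :: "(('d::finite) weights \<times> ('d dedge \<Rightarrow> bool)) set \<Rightarrow> bool" where
  "graph_cylinder A \<longleftrightarrow>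
     (\<exists>F. finite F \<and> A = \<Union>F \<and>
        (\<forall>W\<in>F. \<exists>U cs. U \<in> sets weight_space \<and> fst ` set cs \<subseteq> dedges \<and>
           W = U \<times> {\<eta> \<in> space direction_space. \<forall>(e, a)\<in>set cs. \<eta> e = a}))"

definition lift_event ::
  "(('d::finite) weights \<times> ('d dedge \<Rightarrow> bool)) set \<Rightarrow> 'd config set" where
  "lift_event A = {(t, B, \<eta>). (t, B, \<eta>) \<in> space config_space \<and> (t, \<eta>) \<in> A}"

definition approximable ::
  "real ^ 'd \<Rightarrow> ('d::finite) config measure \<Rightarrow> 'd edge \<Rightarrow> ('d weights \<times> ('d dedge \<Rightarrow> bool)) set \<Rightarrow> bool"
where
  "approximable \<rho> \<mu> e\<^sub>0 A \<longleftrightarrow>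
     A \<in> sets (weight_space \<Otimes>\<^sub>M direction_space) \<and>
     (\<exists>C :: nat \<Rightarrow> _.
        (\<forall>n. graph_cylinder (C n)) \<and>
        (\<lambda>n. measure \<mu> (sym_diff (lift_event (C n)) (lift_event A))) \<longlonglongrightarrow> 0 \<and>
        (\<forall>n. \<exists>\<alpha>\<^sub>0::real. \<forall>\<alpha>\<ge>\<alpha>\<^sub>0. \<forall>t\<in>space weight_space. \<forall>t'\<in>space weight_space.
           t' e\<^sub>0 \<ge> t e\<^sub>0 \<and> (\<forall>e\<in>edges - {e\<^sub>0}. t' e = t e) \<longrightarrow>
           (t, direction \<rho> \<alpha> t) \<in> C n \<longrightarrow> (t', direction \<rho> \<alpha> t') \<in> C n))"

definition weight_sup :: "('d::finite) config measure \<Rightarrow> 'd edge \<Rightarrow> ereal" where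
  "weight_sup \<mu> e = Sup {ereal x | x. x \<ge> 0 \<and> measure \<mu> {w \<in> space \<mu>. fst w e \<ge> x} > 0}"

end

theory Submission
  imports Defs
begin

text \<open>
  Fix a threshold \<open>\<kappa>\<close> and a weight \<open>x > \<kappa>\<close> that edges reach with positive probability.  If \<open>D\<close> is
  an event for the weights that is preserved by raising \<open>t e\<^sub>0\<close>, then replacing \<open>t e\<^sub>0\<close> by \<open>x\<close> yields
  an event \<open>F\<close> depending only on the other weights, which contains the part of \<open>D\<close> where
  \<open>t e\<^sub>0 < x\<close> and is contained in \<open>D\<close> where \<open>t e\<^sub>0 \<ge> x\<close>.  Given the other weights,
  \<open>t e\<^sub>0 \<ge> x\<close> has positive conditional probability, hence conditional probability at least some
  \<open>c > 0\<close> outside an event of probability \<open>\<delta>\<close>.  With a smaller \<open>c > 0\<close> this gives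
  the linear bound (\<open>resampling_increasing\<close>)
  \<open>P(D, t e\<^sub>0 \<ge> x) \<ge> c (P(D) - \<delta>)\<close>
  in which \<open>c\<close> depends on \<open>\<delta>\<close> but not on \<open>D\<close>.

  For an approximating graph-cylinder event \<open>C\<close> and every level \<open>\<alpha> \<ge> \<alpha>\<^sub>0\<close>, the bound applies to the set
  of weights whose image under \<open>\<Phi>\<^sub>\<alpha>\<close> lies in \<open>C\<close>.  Because it is linear it survives averaging over
  \<open>\<alpha> \<in> [0, m]\<close>, with an error \<open>\<alpha>\<^sub>0 / m\<close> from the small levels (\<open>mu_star_lower_bound\<close>), then the
  weak limit along the subsequence (\<open>increasing_cylinder_bound\<close>), and finally the limit along the
  sequence approximating \<open>A\<close> (\<open>approximable_bound\<close>).  With \<open>\<delta> = r / 2\<close> the theorem holds for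
  \<open>s = c r / 2\<close>.

  Two points need work beyond this computation.  The averaged measures are honest probability
  measures because passage times to a hyperplane are jointly measurable in the level and the weights
  (\<open>measurable_config_map\<close>, \<open>mu_star_eq_distr\<close>).  And weak convergence only tests
  continuous functions, whereas a graph cylinder constrains the weights by an arbitrary Borel set;
  but all averaged measures have the same weight marginal \<open>P\<close>, so that the indicator of such an event
  is an \<open>L\<^sup>1\<close> limit of continuous functions uniformly over these measures
  (\<open>approx_graph_cylinder\<close>), and their probabilities do converge.
\<close>

section \<open>Events approximable by continuous functions\<close>

text \<open>
  The two bounds hold with the same function for all measures of the family at once: this
  uniformity is what lets probabilities of such events pass to a weak limit.
\<close>

definition continuity_approx :: "'a topology \<Rightarrow> 'a measure set \<Rightarrow> 'a set \<Rightarrow> bool" where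
  "continuity_approx X MM E \<longleftrightarrow>
     (\<forall>M\<in>MM. E \<in> sets M) \<and>
     (\<forall>\<epsilon>>0. \<exists>f :: 'a \<Rightarrow> real. continuous_map X euclideanreal f \<and> (\<forall>x. 0 \<le> f x \<and> f x \<le> 1) \<and>
        (\<forall>M\<in>MM. f \<in> borel_measurable M \<and> (\<integral>x. \<bar>indicator E x - f x\<bar> \<partial>M) \<le> \<epsilon>))"

lemma integrable_unit_interval_valued:
  fixes f :: "'a \<Rightarrow> real"
  assumes "prob_space M" "f \<in> borel_measurable M" "\<And>x. 0 \<le> f x \<and> f x \<le> 1"
  shows "integrable M f"
proof -
  interpret prob_space M by fact
  show ?thesis
    by (rule integrable_const_bound[of _ 1]) (use assms in auto)
qed

lemma integrable_indicator_distance: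
  fixes f :: "'a \<Rightarrow> real"
  assumes "prob_space M" "f \<in> borel_measurable M" "\<And>x. 0 \<le> f x \<and> f x \<le> 1" "E \<in> sets M"
  shows "integrable M (\<lambda>x. \<bar>indicator E x - f x\<bar>)"
  using integrable_unit_interval_valued[OF assms(1-3)] assms(4)
    integrable_unit_interval_valued[OF assms(1), of "indicator E"]
  by (intro integrable_abs Bochner_Integration.integrable_diff) auto

lemma continuity_approx_sets: "continuity_approx X MM E \<Longrightarrow> M \<in> MM \<Longrightarrow> E \<in> sets M"
  by (simp add: continuity_approx_def)

lemma continuity_approxE:
  assumes "continuity_approx X MM E" "\<epsilon> > 0"
  obtains f :: "'a \<Rightarrow> real" where "continuous_map X euclideanreal f" "\<And>x. 0 \<le> f x \<and> f x \<le> 1"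
    "\<And>M. M \<in> MM \<Longrightarrow> f \<in> borel_measurable M"
    "\<And>M. M \<in> MM \<Longrightarrow> (\<integral>x. \<bar>indicator E x - f x\<bar> \<partial>M) \<le> \<epsilon>"
  using assms unfolding continuity_approx_def by meson

lemma continuity_approx_complement:
  assumes E: "continuity_approx X MM E" and MM: "\<And>M. M \<in> MM \<Longrightarrow> space M = \<Omega>"
  shows "continuity_approx X MM (\<Omega> - E)"
  unfolding continuity_approx_def
proof (intro conjI allI impI ballI)
  show "\<Omega> - E \<in> sets M" if "M \<in> MM" for M
    using continuity_approx_sets[OF E that] MM[OF that] sets.compl_sets by blast
  fix \<epsilon> :: real assume "\<epsilon> > 0"
  obtain f :: "'a \<Rightarrow> real"
    where f: "continuous_map X euclideanreal f" "\<And>x. 0 \<le> f x \<and> f x \<le> 1"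
    "\<And>M. M \<in> MM \<Longrightarrow> f \<in> borel_measurable M"
    "\<And>M. M \<in> MM \<Longrightarrow> (\<integral>x. \<bar>indicator E x - f x\<bar> \<partial>M) \<le> \<epsilon>"
    by (rule continuity_approxE[OF E \<open>\<epsilon> > 0\<close>]) blast
  have "(\<integral>x. \<bar>indicator (\<Omega> - E) x - (1 - f x)\<bar> \<partial>M) = (\<integral>x. \<bar>indicator E x - f x\<bar> \<partial>M)"
    if "M \<in> MM" for M
    by (rule Bochner_Integration.integral_cong) (auto simp: MM[OF that] indicator_def)
  then show "\<exists>g. continuous_map X euclideanreal g \<and> (\<forall>x. 0 \<le> g x \<and> g x \<le> 1) \<and>
      (\<forall>M\<in>MM. g \<in> borel_measurable M \<and> (\<integral>x. \<bar>indicator (\<Omega> - E) x - g x\<bar> \<partial>M) \<le> \<epsilon>)"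
    using f by (intro exI[of _ "\<lambda>x. 1 - f x"]) (auto intro!: continuous_intros)
qed

lemma continuity_approx_Int:
  assumes E: "continuity_approx X MM E" and F: "continuity_approx X MM F"
    and MM: "\<And>M. M \<in> MM \<Longrightarrow> prob_space M"
  shows "continuity_approx X MM (E \<inter> F)"
  unfolding continuity_approx_def
proof (intro conjI allI impI ballI)
  show "E \<inter> F \<in> sets M" if "M \<in> MM" for M
    using continuity_approx_sets[OF E that] continuity_approx_sets[OF F that] by blast
  fix \<epsilon> :: real assume "\<epsilon> > 0"
  then have e2: "\<epsilon> / 2 > 0" by simp
  obtain f :: "'a \<Rightarrow> real"
    where f: "continuous_map X euclideanreal f" "\<And>x. 0 \<le> f x \<and> f x \<le> 1"
    "\<And>M. M \<in> MM \<Longrightarrow> f \<in> borel_measurable M"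
    "\<And>M. M \<in> MM \<Longrightarrow> (\<integral>x. \<bar>indicator E x - f x\<bar> \<partial>M) \<le> \<epsilon> / 2"
    by (rule continuity_approxE[OF E e2]) blast
  obtain g :: "'a \<Rightarrow> real"
    where g: "continuous_map X euclideanreal g" "\<And>x. 0 \<le> g x \<and> g x \<le> 1"
    "\<And>M. M \<in> MM \<Longrightarrow> g \<in> borel_measurable M"
    "\<And>M. M \<in> MM \<Longrightarrow> (\<integral>x. \<bar>indicator F x - g x\<bar> \<partial>M) \<le> \<epsilon> / 2"
    by (rule continuity_approxE[OF F e2]) blast
  have fg: "0 \<le> f x * g x \<and> f x * g x \<le> 1" for x
    using f(2)[of x] g(2)[of x] mult_le_one[of "f x" "g x"] by simp
  have pw: "\<bar>indicator (E \<inter> F) x - f x * g x\<bar> \<le> \<bar>indicator E x - f x\<bar> + \<bar>indicator F x - g x\<bar>" for x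
  proof -
    have "indicator (E \<inter> F) x - f x * g x
        = (indicator E x - f x) * indicator F x + f x * (indicator F x - g x)"
      by (simp add: indicator_inter_arith algebra_simps)
    moreover have "\<bar>(indicator E x - f x) * indicator F x\<bar> \<le> \<bar>indicator E x - f x\<bar>"
      by (simp add: indicator_def)
    moreover have "\<bar>f x * (indicator F x - g x)\<bar> \<le> \<bar>indicator F x - g x\<bar>"
      using f(2)[of x] by (simp add: abs_mult mult_left_le_one_le)
    ultimately show ?thesis by linarith
  qed
  have "(\<integral>x. \<bar>indicator (E \<inter> F) x - f x * g x\<bar> \<partial>M) \<le> \<epsilon>" if M: "M \<in> MM" for M
  proof -
    note int = integrable_indicator_distance[OF MM[OF M]]
    have i1: "integrable M (\<lambda>x. \<bar>indicator E x - f x\<bar>)"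
      using f M continuity_approx_sets[OF E M] by (intro int) auto
    have i2: "integrable M (\<lambda>x. \<bar>indicator F x - g x\<bar>)"
      using g M continuity_approx_sets[OF F M] by (intro int) auto
    have "integrable M (\<lambda>x. \<bar>indicator (E \<inter> F) x - f x * g x\<bar>)"
      using fg f(3) g(3) M continuity_approx_sets[OF E M] continuity_approx_sets[OF F M]
      by (intro int) auto
    then have "(\<integral>x. \<bar>indicator (E \<inter> F) x - f x * g x\<bar> \<partial>M)
        \<le> (\<integral>x. \<bar>indicator E x - f x\<bar> + \<bar>indicator F x - g x\<bar> \<partial>M)"
      by (intro integral_mono Bochner_Integration.integrable_add i1 i2 pw)
    also have "\<dots> \<le> \<epsilon>"
      using f(4)[OF M] g(4)[OF M] by (simp add: Bochner_Integration.integral_add[OF i1 i2])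
    finally show ?thesis .
  qed
  then show "\<exists>h. continuous_map X euclideanreal h \<and> (\<forall>x. 0 \<le> h x \<and> h x \<le> 1) \<and>
      (\<forall>M\<in>MM. h \<in> borel_measurable M \<and> (\<integral>x. \<bar>indicator (E \<inter> F) x - h x\<bar> \<partial>M) \<le> \<epsilon>)"
    using f(1,3) g(1,3) fg by (intro exI[of _ "\<lambda>x. f x * g x"]) (auto intro!: continuous_intros)
qed

lemma continuity_approx_Un:
  assumes E: "continuity_approx X MM E" and F: "continuity_approx X MM F"
    and MM: "\<And>M. M \<in> MM \<Longrightarrow> prob_space M" "\<And>M. M \<in> MM \<Longrightarrow> space M = \<Omega>"
    and EF: "E \<union> F \<subseteq> \<Omega>"
  shows "continuity_approx X MM (E \<union> F)"
proof -
  have "continuity_approx X MM (\<Omega> - ((\<Omega> - E) \<inter> (\<Omega> - F)))"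
    by (intro continuity_approx_complement continuity_approx_Int E F MM)
  also have "\<Omega> - ((\<Omega> - E) \<inter> (\<Omega> - F)) = E \<union> F"
    using EF by blast
  finally show ?thesis .
qed

lemma continuity_approx_indicator:
  assumes "continuous_map X euclideanreal (indicator E :: 'a \<Rightarrow> real)"
    and "\<And>M. M \<in> MM \<Longrightarrow> E \<in> sets M"
  shows "continuity_approx X MM E"
  unfolding continuity_approx_def
  using assms by (intro conjI allI impI exI[of _ "indicator E"]) (auto simp: indicator_def)

text \<open>
  The triangle inequality in \<open>L\<^sup>1\<close>.  The approximation has to be uniform over the family, so a
  countable union is reached from its finite parts only when its tails are uniformly small.
\<close>

lemma continuity_approx_limit:
  assumes MM: "\<And>M. M \<in> MM \<Longrightarrow> prob_space M" and E: "\<And>M. M \<in> MM \<Longrightarrow> E \<in> sets M"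
    and lim: "\<And>\<epsilon>. \<epsilon> > 0 \<Longrightarrow>
      \<exists>F. continuity_approx X MM F \<and> (\<forall>M\<in>MM. measure M (sym_diff E F) \<le> \<epsilon>)"
  shows "continuity_approx X MM E"
  unfolding continuity_approx_def
proof (intro conjI allI impI ballI E)
  fix \<epsilon> :: real assume "\<epsilon> > 0"
  then have e2: "\<epsilon> / 2 > 0" by simp
  from lim[OF this] obtain F where F: "continuity_approx X MM F"
    and EF: "\<And>M. M \<in> MM \<Longrightarrow> measure M (sym_diff E F) \<le> \<epsilon> / 2"
    by blast
  obtain f :: "'a \<Rightarrow> real"
    where f: "continuous_map X euclideanreal f" "\<And>x. 0 \<le> f x \<and> f x \<le> 1"
    "\<And>M. M \<in> MM \<Longrightarrow> f \<in> borel_measurable M"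
    "\<And>M. M \<in> MM \<Longrightarrow> (\<integral>x. \<bar>indicator F x - f x\<bar> \<partial>M) \<le> \<epsilon> / 2"
    by (rule continuity_approxE[OF F e2]) blast
  have "(\<integral>x. \<bar>indicator E x - f x\<bar> \<partial>M) \<le> \<epsilon>" if M: "M \<in> MM" for M
  proof -
    interpret prob_space M using MM[OF M] .
    have [measurable]: "E \<in> sets M" "F \<in> sets M" "f \<in> borel_measurable M"
      using E[OF M] continuity_approx_sets[OF F M] f(3)[OF M] .
    note int = integrable_indicator_distance[OF MM[OF M]]
    have i1: "integrable M (\<lambda>x. \<bar>indicator E x - f x\<bar>)" "integrable M (\<lambda>x. \<bar>indicator F x - f x\<bar>)"
      using f(2) by (auto intro!: int)
    have i2: "integrable M (indicator (sym_diff E F) :: 'a \<Rightarrow> real)"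
      by (rule integrable_real_indicator) (auto simp: emeasure_eq_measure)
    have "(\<integral>x. \<bar>indicator E x - f x\<bar> \<partial>M)
        \<le> (\<integral>x. indicator (sym_diff E F) x + \<bar>indicator F x - f x\<bar> \<partial>M)"
      by (intro integral_mono i1 i2 Bochner_Integration.integrable_add) (auto simp: indicator_def)
    also have "\<dots> = measure M (sym_diff E F) + (\<integral>x. \<bar>indicator F x - f x\<bar> \<partial>M)"
      using i1 i2 by simp
    also have "\<dots> \<le> \<epsilon>"
      using EF[OF M] f(4)[OF M] by simp
    finally show ?thesis .
  qed
  then show "\<exists>f. continuous_map X euclideanreal f \<and> (\<forall>x. 0 \<le> f x \<and> f x \<le> 1) \<and>
      (\<forall>M\<in>MM. f \<in> borel_measurable M \<and> (\<integral>x. \<bar>indicator E x - f x\<bar> \<partial>M) \<le> \<epsilon>)"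
    using f by blast
qed

text \<open>
  Replacing the indicator by the approximating function costs the same small amount under every
  measure of the family, the limit included.
\<close>

lemma continuity_approx_convergence:
  assumes E: "continuity_approx X MM E"
    and MM: "\<And>M. M \<in> MM \<Longrightarrow> prob_space M"
    and N: "N \<in> MM" and M: "\<forall>\<^sub>F n in sequentially. M n \<in> MM"
    and conv: "converges_weakly X M N"
  shows "(\<lambda>n. measure (M n) E) \<longlonglongrightarrow> measure N E"
proof (rule tendstoI)
  fix \<epsilon> :: real assume "\<epsilon> > 0"
  then have e3: "\<epsilon> / 3 > 0" by simp
  obtain f :: "'a \<Rightarrow> real"
    where f: "continuous_map X euclideanreal f" "\<And>x. 0 \<le> f x \<and> f x \<le> 1"
    "\<And>M. M \<in> MM \<Longrightarrow> f \<in> borel_measurable M"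
    "\<And>M. M \<in> MM \<Longrightarrow> (\<integral>x. \<bar>indicator E x - f x\<bar> \<partial>M) \<le> \<epsilon> / 3"
    by (rule continuity_approxE[OF E e3]) blast
  have near: "\<bar>measure L E - (\<integral>x. f x \<partial>L)\<bar> \<le> \<epsilon> / 3" if L: "L \<in> MM" for L
  proof -
    interpret prob_space L using MM[OF L] .
    have [measurable]: "E \<in> sets L" "f \<in> borel_measurable L"
      using continuity_approx_sets[OF E L] f(3)[OF L] .
    have "integrable L f"
      by (rule integrable_unit_interval_valued) (use MM[OF L] f(2) in auto)
    moreover have "integrable L (indicator E :: 'a \<Rightarrow> real)"
      by (rule integrable_real_indicator) (auto simp: emeasure_eq_measure)
    ultimately have "measure L E - (\<integral>x. f x \<partial>L) = (\<integral>x. indicator E x - f x \<partial>L)"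
      by simp
    then have "\<bar>measure L E - (\<integral>x. f x \<partial>L)\<bar> \<le> (\<integral>x. \<bar>indicator E x - f x\<bar> \<partial>L)"
      by (simp add: integral_abs_bound)
    with f(4)[OF L] show ?thesis by linarith
  qed
  have "bounded (f ` topspace X)"
    unfolding bounded_iff using f(2) by (intro exI[of _ 1]) auto
  with conv f(1) have "(\<lambda>n. \<integral>x. f x \<partial>M n) \<longlonglongrightarrow> (\<integral>x. f x \<partial>N)"
    unfolding converges_weakly_def by blast
  from tendstoD[OF this e3] M
  show "\<forall>\<^sub>F n in sequentially. dist (measure (M n) E) (measure N E) < \<epsilon>"
  proof eventually_elim
    case (elim n)
    with near[of "M n"] near[OF N] show ?case
      unfolding dist_real_def by linarith
  qed
qed

section \<open>Measurability of passage times and geodesics\<close>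

lemma space_weight_space: "space weight_space = (\<Pi>\<^sub>E e\<in>edges. {0..})"
  by (simp add: weight_space_def space_PiM)

lemma weight_nonneg: "t \<in> space weight_space \<Longrightarrow> e \<in> edges \<Longrightarrow> 0 \<le> t e"
  by (auto simp: space_weight_space)

lemma measurable_weight: "e \<in> edges \<Longrightarrow> (\<lambda>t. t e) \<in> borel_measurable weight_space"
  unfolding weight_space_def
  using measurable_component_singleton[of e edges "\<lambda>_. restrict_space borel {0::real..}"]
  by (auto simp: measurable_restrict_space2_iff)

lemma measurable_path_time:
  assumes "lattice_path p"
  shows "(\<lambda>t. path_time t p) \<in> borel_measurable weight_space"
  unfolding path_time_def
  by (intro borel_measurable_sum measurable_weight) (use assms in \<open>auto simp: lattice_path_def\<close>)

lemma path_time_nonneg: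
  assumes "t \<in> space weight_space" "lattice_path p"
  shows "0 \<le> path_time t p"
  unfolding path_time_def
  by (intro sum_nonneg weight_nonneg assms(1)) (use assms(2) in \<open>auto simp: lattice_path_def\<close>)

lemma measurable_lattice_time:
  "(\<lambda>t. lattice_time t x y) \<in> borel_measurable weight_space"
  unfolding lattice_time_def
proof (rule borel_measurable_cINF)
  fix t :: "'a weights" assume "t \<in> space weight_space"
  then show "bdd_below (path_time t ` {p. path_between x y p})"
    by (auto simp: bdd_below_def path_between_def intro!: exI[of _ 0] path_time_nonneg)
qed (auto simp: path_between_def intro!: measurable_path_time)

text \<open>
  The term \<open>Inf {}\<close> is the value of an infimum over no path; keeping it avoids an appeal to the
  connectedness of the lattice.
\<close>

lemma lattice_time_lower_bound:
  assumes "t \<in> space weight_space"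
  shows "min 0 (Inf {}) \<le> lattice_time t x y"
proof (cases "{p. path_between x y p} = {}")
  case True
  then show ?thesis by (simp add: lattice_time_def)
next
  case False
  then have "0 \<le> lattice_time t x y"
    unfolding lattice_time_def
    by (intro cINF_greatest) (auto simp: path_between_def intro!: path_time_nonneg assms)
  then show ?thesis by simp
qed

lemma floor_vec_real_vec [simp]: "floor_vec (real_vec x) = x"
  by (simp add: floor_vec_def real_vec_def vec_eq_iff)

text \<open>
  Passage times to a region only see which unit cells the region meets, so the infimum is a
  countable one.
\<close>

lemma set_time_floor_vec:
  "set_time t {real_vec x} B = (INF v\<in>floor_vec ` B. lattice_time t x v)"
proof -
  have "(\<lambda>(x, y). point_time t x y) ` ({real_vec x} \<times> B) = lattice_time t x ` floor_vec ` B"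
    by (auto simp: point_time_def image_iff)
  then show ?thesis
    unfolding set_time_def by simp
qed

lemma hyperplane_nonempty:
  fixes \<rho> :: "real ^ 'd"
  assumes "\<rho> \<noteq> 0"
  shows "hyperplane \<rho> \<alpha> \<noteq> {}"
proof -
  have "(\<alpha> / (\<rho> \<bullet> \<rho>)) *\<^sub>R \<rho> \<in> hyperplane \<rho> \<alpha>"
    using assms by (simp add: hyperplane_def)
  then show ?thesis by blast
qed

text \<open>
  The levels whose hyperplane meets a given cell form an interval, being the image of a convex set
  under a linear functional.
\<close>

lemma hyperplane_meets_cell_measurable:
  "{\<alpha>. v \<in> floor_vec ` hyperplane \<rho> \<alpha>} \<in> sets borel"
proof -
  have eq: "{\<alpha>. v \<in> floor_vec ` hyperplane \<rho> \<alpha>} = (\<lambda>z. z \<bullet> \<rho>) ` {z. floor_vec z = v}"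
    by (auto simp: hyperplane_def)
  have "{z. floor_vec z = v}
      = (\<Inter>i. {z. axis i 1 \<bullet> z \<ge> real_of_int (v $ i)} \<inter> {z. axis i 1 \<bullet> z < real_of_int (v $ i) + 1})"
    by (auto simp: floor_vec_def vec_eq_iff floor_eq_iff inner_axis')
  then have "convex {z. floor_vec z = v}"
    by (auto intro!: convex_INT convex_Int convex_halfspace_ge convex_halfspace_lt)
  then have "convex ((\<lambda>z. z \<bullet> \<rho>) ` {z. floor_vec z = v})"
    by (intro convex_linear_image bounded_linear.linear bounded_linear_inner_left)
  then show ?thesis
    unfolding eq by (intro real_interval_borel_measurable) (simp add: is_interval_convex_1)
qed

lemma measurable_set_time:
  fixes \<rho> :: "real ^ ('d::finite)"
  assumes "\<rho> \<noteq> 0"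
  shows "(\<lambda>w. set_time (snd w) {real_vec x} (hyperplane \<rho> (fst w)))
           \<in> borel_measurable (borel \<Otimes>\<^sub>M weight_space)"
  unfolding borel_measurable_iff_less
proof
  fix c :: real
  have "{w \<in> space (borel \<Otimes>\<^sub>M weight_space). set_time (snd w) {real_vec x} (hyperplane \<rho> (fst w)) < c}
      = (\<Union>v. {\<alpha>. v \<in> floor_vec ` hyperplane \<rho> \<alpha>} \<times> {t \<in> space weight_space. lattice_time t x v < c})"
  proof -
    have "set_time t {real_vec x} (hyperplane \<rho> \<alpha>) < c \<longleftrightarrow>
        (\<exists>v. v \<in> floor_vec ` hyperplane \<rho> \<alpha> \<and> lattice_time t x v < c)"
      if t: "t \<in> space weight_space" for \<alpha> t
      unfolding set_time_floor_vec
      using hyperplane_nonempty[OF assms, of \<alpha>] lattice_time_lower_bound[OF t]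
      by (subst cINF_less_iff) (auto simp: bdd_below_def intro!: exI[of _ "min 0 (Inf {})"])
    then show ?thesis
      by (auto simp: space_pair_measure)
  qed
  also have "\<dots> \<in> sets (borel \<Otimes>\<^sub>M weight_space)"
  proof (rule sets.countable_UN'')
    fix v :: "'d vertex"
    have "{t \<in> space weight_space. lattice_time t x v < c} \<in> sets weight_space"
      using measurable_lattice_time[of x v] by (simp add: borel_measurable_iff_less)
    then show "{\<alpha>. v \<in> floor_vec ` hyperplane \<rho> \<alpha>} \<times> {t \<in> space weight_space. lattice_time t x v < c}
        \<in> sets (borel \<Otimes>\<^sub>M weight_space)"
      by (intro pair_measureI hyperplane_meets_cell_measurable)
  qed auto
  finally show "{w \<in> space (borel \<Otimes>\<^sub>M weight_space). 
    set_time (snd w) {real_vec x} (hyperplane \<rho> (fst w)) < c} \<in> sets (borel \<Otimes>\<^sub>M weight_space)" .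
qed

lemma measurable_direction:
  fixes \<rho> :: "real ^ ('d::finite)"
  assumes "\<rho> \<noteq> 0"
  shows "(\<lambda>w. direction \<rho> (fst w) (snd w)) \<in> borel \<Otimes>\<^sub>M weight_space \<rightarrow>\<^sub>M direction_space"
  unfolding direction_def direction_space_def
proof (rule measurable_restrict)
  fix d :: "'d dedge"
  obtain x y where d: "d = (x, y)" by fastforce
  let ?M = "borel \<Otimes>\<^sub>M weight_space :: (real \<times> 'd weights) measure"
  let ?Q = "\<lambda>p w. last p \<in> floor_vec ` hyperplane \<rho> (fst w)
        \<and> path_time (snd w) p = set_time (snd w) {real_vec x} (hyperplane \<rho> (fst w))"
  have Q: "Measurable.pred ?M (?Q p)" if p: "lattice_path p" for p
  proof (intro pred_intros_logic)
    have "{\<alpha>. last p \<in> floor_vec ` hyperplane \<rho> \<alpha>} \<in> sets borel"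
      by (rule hyperplane_meets_cell_measurable)
    then have "Measurable.pred borel (\<lambda>\<alpha>. last p \<in> floor_vec ` hyperplane \<rho> \<alpha>)"
      by (simp add: pred_def)
    then show "Measurable.pred ?M (\<lambda>w. last p \<in> floor_vec ` hyperplane \<rho> (fst w))"
      by (rule measurable_compose[OF measurable_fst])
    have [measurable]: "(\<lambda>w. path_time (snd w) p) \<in> borel_measurable ?M"
      by (rule measurable_compose[OF measurable_snd measurable_path_time[OF p]])
    note [measurable] = measurable_set_time[OF assms, of x]
    show "Measurable.pred ?M (\<lambda>w. path_time (snd w) p
        = set_time (snd w) {real_vec x} (hyperplane \<rho> (fst w)))"
      by measurable
  qed
  have eq: "(\<exists>p. geodesic_to t x (hyperplane \<rho> \<alpha>) p \<and> {x, y} \<in> path_edges p) \<longleftrightarrow>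
      (\<exists>p\<in>{p. lattice_path p \<and> hd p = x \<and> {x, y} \<in> path_edges p}. ?Q p (\<alpha>, t))" for \<alpha> t
    by (auto simp: geodesic_to_def path_between_def)
  have "Measurable.pred ?M
      (\<lambda>w. \<exists>p\<in>{p. lattice_path p \<and> hd p = x \<and> {x, y} \<in> path_edges p}. ?Q p w)"
    by (intro pred_intros_countable_bounded Q) auto
  then show "(\<lambda>w. case d of (x, y) \<Rightarrow> \<exists>p. geodesic_to (snd w) x (hyperplane \<rho> (fst w)) p
      \<and> {x, y} \<in> path_edges p) \<in> ?M \<rightarrow>\<^sub>M count_space UNIV"
    by (simp add: d eq)
qed

lemma measurable_config_map:
  fixes \<rho> :: "real ^ ('d::finite)"
  assumes "\<rho> \<noteq> 0"
  shows "(\<lambda>w. config_map \<rho> (fst w) (snd w)) \<in> borel \<Otimes>\<^sub>M weight_space \<rightarrow>\<^sub>M config_space"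
proof -
  note [measurable] = measurable_set_time[OF assms] measurable_direction[OF assms]
  have "(\<lambda>w. busemann \<rho> (fst w) (snd w)) \<in> borel \<Otimes>\<^sub>M weight_space \<rightarrow>\<^sub>M busemann_space"
    unfolding busemann_space_def
  proof (rule measurable_PiM_single')
    fix i :: "'d vertex \<times> 'd vertex"
    show "(\<lambda>w. busemann \<rho> (fst w) (snd w) i) \<in> borel_measurable (borel \<Otimes>\<^sub>M weight_space)"
      by (cases i) (simp add: busemann_def)
  qed auto
  then show ?thesis
    unfolding config_map_def config_space_def by measurable
qed

section \<open>Averaged measures and weak convergence\<close>

abbreviation uniform_level :: "nat \<Rightarrow> real measure" where
  "uniform_level m \<equiv> uniform_measure lborel {0..real m}"

lemma prob_space_uniform_level: "m \<ge> 1 \<Longrightarrow> prob_space (uniform_level m)"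
  by (rule prob_space_uniform_measure) (auto simp: ennreal_eq_0_iff)

lemma measurable_config_map_level:
  fixes \<rho> :: "real ^ ('d::finite)"
  assumes "\<rho> \<noteq> 0" "sets P = sets weight_space"
  shows "config_map \<rho> \<alpha> \<in> P \<rightarrow>\<^sub>M config_space"
proof -
  have "(\<lambda>t. (\<alpha>, t)) \<in> P \<rightarrow>\<^sub>M borel \<Otimes>\<^sub>M weight_space"
    using assms(2) by (simp cong: measurable_cong_sets)
  from measurable_compose[OF this measurable_config_map[OF assms(1)]]
  show ?thesis by simp
qed

lemma measure_mu_alpha:
  fixes \<rho> :: "real ^ ('d::finite)"
  assumes "\<rho> \<noteq> 0" "sets P = sets weight_space" "E \<in> sets config_space"
  shows "measure (mu_alpha P \<rho> \<alpha>) E = measure P {t \<in> space P. config_map \<rho> \<alpha> t \<in> E}"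
  unfolding mu_alpha_def
  by (subst measure_distr[OF measurable_config_map_level[OF assms(1,2)] assms(3)])
    (auto intro!: arg_cong[of _ _ "measure P"])

lemma measurable_emeasure_mu_alpha:
  fixes \<rho> :: "real ^ ('d::finite)"
  assumes "prob_space P" "sets P = sets weight_space" "\<rho> \<noteq> 0" "E \<in> sets config_space"
  shows "(\<lambda>\<alpha>. emeasure (mu_alpha P \<rho> \<alpha>) E) \<in> borel_measurable borel"
proof -
  interpret prob_space P by fact
  let ?\<Psi> = "\<lambda>w. config_map \<rho> (fst w) (snd w)"
  have \<Psi>: "?\<Psi> \<in> borel \<Otimes>\<^sub>M P \<rightarrow>\<^sub>M config_space"
    using measurable_config_map[OF assms(3)] assms(2)
    by (simp cong: measurable_cong_sets sets_pair_measure_cong)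
  have "emeasure (mu_alpha P \<rho> \<alpha>) E
      = emeasure P (Pair \<alpha> -` (?\<Psi> -` E \<inter> space (borel \<Otimes>\<^sub>M P)))" for \<alpha>
    unfolding mu_alpha_def
    by (subst emeasure_distr[OF measurable_config_map_level[OF assms(3,2)] assms(4)])
      (auto intro!: arg_cong[of _ _ "emeasure P"] simp: space_pair_measure)
  moreover have "(\<lambda>\<alpha>. emeasure P (Pair \<alpha> -` (?\<Psi> -` E \<inter> space (borel \<Otimes>\<^sub>M P)))) \<in> borel_measurable borel"
    by (intro measurable_emeasure_Pair measurable_sets[OF \<Psi> assms(4)])
  ultimately show ?thesis by simp
qed

text \<open>
  Fubini: sampling first a uniform level and then the weights produces the averaged measure.
\<close>

lemma averaged_config_map:
  fixes \<rho> :: "real ^ ('d::finite)"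
  assumes "prob_space P" "sets P = sets weight_space" "\<rho> \<noteq> 0" "E \<in> sets config_space"
  shows "emeasure (distr (uniform_level m \<Otimes>\<^sub>M P) config_space (\<lambda>w. config_map \<rho> (fst w) (snd w))) E
    = (\<integral>\<^sup>+\<alpha>. emeasure (mu_alpha P \<rho> \<alpha>) E \<partial>uniform_level m)"
    (is "emeasure (distr ?N _ ?\<Psi>) E = _")
proof -
  interpret prob_space P by fact
  have "sets ?N = sets (borel \<Otimes>\<^sub>M weight_space)"
    by (intro sets_pair_measure_cong) (simp_all add: assms)
  then have \<Psi>: "?\<Psi> \<in> ?N \<rightarrow>\<^sub>M config_space"
    using measurable_config_map[OF assms(3)] by (simp cong: measurable_cong_sets)
  have "emeasure (distr ?N config_space ?\<Psi>) E = emeasure ?N (?\<Psi> -` E \<inter> space ?N)"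
    by (rule emeasure_distr[OF \<Psi> assms(4)])
  also have "\<dots> = (\<integral>\<^sup>+\<alpha>. emeasure P (Pair \<alpha> -` (?\<Psi> -` E \<inter> space ?N)) \<partial>uniform_level m)"
    by (intro emeasure_pair_measure_alt measurable_sets[OF \<Psi> assms(4)])
  also have "\<dots> = (\<integral>\<^sup>+\<alpha>. emeasure (mu_alpha P \<rho> \<alpha>) E \<partial>uniform_level m)"
    unfolding mu_alpha_def
    by (subst emeasure_distr[OF measurable_config_map_level[OF assms(3,2)] assms(4)])
      (auto intro!: nn_integral_cong arg_cong[of _ _ "emeasure P"] simp: space_pair_measure)
  finally show ?thesis .
qed

text \<open>
  The averaging formula is applied to sets by \<open>measure_of\<close>, which yields the zero measure unless the
  formula is countably additive; exhibiting it as the distribution of a random configuration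
  settles this.
\<close>

lemma mu_star_eq_distr:
  fixes \<rho> :: "real ^ ('d::finite)"
  assumes "prob_space P" "sets P = sets weight_space" "\<rho> \<noteq> 0" "m \<ge> 1"
  shows "mu_star P \<rho> m
    = distr (uniform_level m \<Otimes>\<^sub>M P) config_space (\<lambda>w. config_map \<rho> (fst w) (snd w))"
    (is "_ = ?D")
proof -
  have "mu_star P \<rho> m = measure_of (space ?D) (sets ?D) (emeasure ?D)"
    unfolding mu_star_def space_distr sets_distr
  proof (rule measure_of_eq)
    fix E :: "'d config set" assume "E \<in> sigma_sets (space config_space) (sets config_space)"
    then have E: "E \<in> sets config_space"
      by (simp add: sets.sigma_sets_eq)
    have "emeasure ?D E = (\<integral>\<^sup>+\<alpha>. emeasure (mu_alpha P \<rho> \<alpha>) E \<partial>uniform_level m)"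
      by (rule averaged_config_map[OF assms(1-3) E])
    also have "\<dots> = (\<integral>\<^sup>+\<alpha>\<in>{0..real m}. emeasure (mu_alpha P \<rho> \<alpha>) E \<partial>lborel)
        / emeasure lborel {0..real m}"
      using measurable_emeasure_mu_alpha[OF assms(1-3) E] by (intro nn_integral_uniform_measure) auto
    finally show "(\<integral>\<^sup>+\<alpha>\<in>{0..real m}. emeasure (mu_alpha P \<rho> \<alpha>) E \<partial>lborel) / of_nat m
        = emeasure ?D E"
      by (simp add: ennreal_of_nat_eq_real_of_nat)
  qed (rule sets.space_closed)
  then show ?thesis
    by (simp only: measure_of_of_measure)
qed

lemma sets_mu_star [simp]: "sets (mu_star P \<rho> m) = sets config_space"
  unfolding mu_star_def by (simp add: sets.space_closed sets.sigma_sets_eq)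

lemma space_mu_star [simp]: "space (mu_star P \<rho> m) = space config_space"
  by (rule sets_eq_imp_space_eq) simp

lemma prob_space_mu_alpha:
  fixes \<rho> :: "real ^ ('d::finite)"
  assumes "prob_space P" "sets P = sets weight_space" "\<rho> \<noteq> 0"
  shows "prob_space (mu_alpha P \<rho> \<alpha>)"
  unfolding mu_alpha_def
  using prob_space.prob_space_distr[OF assms(1) measurable_config_map_level[OF assms(3,2)]] .

lemma emeasure_mu_star:
  fixes \<rho> :: "real ^ ('d::finite)"
  assumes "prob_space P" "sets P = sets weight_space" "\<rho> \<noteq> 0" "m \<ge> 1" "E \<in> sets config_space"
  shows "emeasure (mu_star P \<rho> m) E = (\<integral>\<^sup>+\<alpha>. emeasure (mu_alpha P \<rho> \<alpha>) E \<partial>uniform_level m)"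
  using averaged_config_map[OF assms(1-3,5)] by (simp add: mu_star_eq_distr[OF assms(1-4)])

lemma prob_space_mu_star:
  fixes \<rho> :: "real ^ ('d::finite)"
  assumes "prob_space P" "sets P = sets weight_space" "\<rho> \<noteq> 0" "m \<ge> 1"
  shows "prob_space (mu_star P \<rho> m)"
proof
  interpret U: prob_space "uniform_level m" by (rule prob_space_uniform_level) fact
  have "emeasure (mu_alpha P \<rho> \<alpha>) (space config_space) = 1" for \<alpha>
    using prob_space.emeasure_space_1[OF prob_space_mu_alpha[OF assms(1-3), of \<alpha>]]
    by (simp add: mu_alpha_def)
  then show "emeasure (mu_star P \<rho> m) (space (mu_star P \<rho> m)) = 1"
    using U.emeasure_space_1 by (simp add: emeasure_mu_star[OF assms])
qed

lemma measure_mu_star: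
  fixes \<rho> :: "real ^ ('d::finite)"
  assumes "prob_space P" "sets P = sets weight_space" "\<rho> \<noteq> 0" "m \<ge> 1" "E \<in> sets config_space"
  shows "integrable (uniform_level m) (\<lambda>\<alpha>. measure (mu_alpha P \<rho> \<alpha>) E)"
    and "measure (mu_star P \<rho> m) E = (\<integral>\<alpha>. measure (mu_alpha P \<rho> \<alpha>) E \<partial>uniform_level m)"
proof -
  interpret U: prob_space "uniform_level m" by (rule prob_space_uniform_level) fact
  interpret A: prob_space "mu_alpha P \<rho> \<alpha>" for \<alpha>
    by (rule prob_space_mu_alpha[OF assms(1-3)])
  have [measurable]: "(\<lambda>\<alpha>. measure (mu_alpha P \<rho> \<alpha>) E) \<in> borel_measurable borel"
    unfolding measure_def using measurable_emeasure_mu_alpha[OF assms(1-3,5)] by measurable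
  show int: "integrable (uniform_level m) (\<lambda>\<alpha>. measure (mu_alpha P \<rho> \<alpha>) E)"
    by (rule U.integrable_const_bound[of _ 1]) auto
  have "emeasure (mu_star P \<rho> m) E = (\<integral>\<^sup>+\<alpha>. ennreal (measure (mu_alpha P \<rho> \<alpha>) E) \<partial>uniform_level m)"
    by (simp add: emeasure_mu_star[OF assms] A.emeasure_eq_measure)
  also have "\<dots> = ennreal (\<integral>\<alpha>. measure (mu_alpha P \<rho> \<alpha>) E \<partial>uniform_level m)"
    by (rule nn_integral_eq_integral[OF int]) auto
  finally show "measure (mu_star P \<rho> m) E = (\<integral>\<alpha>. measure (mu_alpha P \<rho> \<alpha>) E \<partial>uniform_level m)"
    by (simp add: measure_def integral_nonneg_AE)
qed

text \<open>
  Below the level \<open>\<alpha>\<^sub>0\<close> nothing is assumed, but there \<open>c (P(E) - \<delta> - 1) \<le> 0\<close>, and these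
  levels have uniform probability at most \<open>\<alpha>\<^sub>0 / m\<close>.
\<close>

lemma mu_star_lower_bound:
  fixes \<rho> :: "real ^ ('d::finite)"
  assumes P: "prob_space P" "sets P = sets weight_space" "\<rho> \<noteq> 0" "m \<ge> 1"
    and E: "E \<in> sets config_space" and F: "F \<in> sets config_space"
    and c: "c \<ge> 0" and \<delta>: "\<delta> \<ge> 0" and \<alpha>\<^sub>0: "\<alpha>\<^sub>0 \<ge> 0"
    and le: "\<And>\<alpha>. \<alpha> \<ge> \<alpha>\<^sub>0 \<Longrightarrow>
      c * (measure (mu_alpha P \<rho> \<alpha>) E - \<delta>) \<le> measure (mu_alpha P \<rho> \<alpha>) F"
  shows "c * (measure (mu_star P \<rho> m) E - \<delta> - \<alpha>\<^sub>0 / m) \<le> measure (mu_star P \<rho> m) F"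
proof -
  interpret U: prob_space "uniform_level m" by (rule prob_space_uniform_level) fact
  interpret A: prob_space "mu_alpha P \<rho> \<alpha>" for \<alpha>
    by (rule prob_space_mu_alpha[OF P(1-3)])
  note int = measure_mu_star(1)[OF P E] measure_mu_star(1)[OF P F]
  have ind: "integrable (uniform_level m) (indicator {..<\<alpha>\<^sub>0} :: real \<Rightarrow> real)"
    by (rule integrable_real_indicator) (auto simp: U.emeasure_eq_measure)
  have "measure (uniform_level m) {..<\<alpha>\<^sub>0} = measure lborel ({0..real m} \<inter> {..<\<alpha>\<^sub>0}) / m"
    using P(4) by (subst measure_uniform_measure) auto
  also have "\<dots> \<le> measure lborel {0..\<alpha>\<^sub>0} / m"
    using \<alpha>\<^sub>0 by (intro divide_right_mono measure_mono_fmeasurable) (auto simp: fmeasurable_def)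
  finally have small: "measure (uniform_level m) {..<\<alpha>\<^sub>0} \<le> \<alpha>\<^sub>0 / m"
    using \<alpha>\<^sub>0 by simp
  have "c * (measure (mu_star P \<rho> m) E - \<delta> - \<alpha>\<^sub>0 / m)
      \<le> c * (measure (mu_star P \<rho> m) E - \<delta> - measure (uniform_level m) {..<\<alpha>\<^sub>0})"
    using small c by (intro mult_left_mono) auto
  also have "\<dots> = (\<integral>\<alpha>. c * (measure (mu_alpha P \<rho> \<alpha>) E - \<delta> - indicator {..<\<alpha>\<^sub>0} \<alpha>) \<partial>uniform_level m)"
    using int ind U.prob_space by (simp add: measure_mu_star(2)[OF P E])
  also have "\<dots> \<le> (\<integral>\<alpha>. measure (mu_alpha P \<rho> \<alpha>) F \<partial>uniform_level m)"
  proof (rule integral_mono)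
    fix \<alpha> :: real
    show "c * (measure (mu_alpha P \<rho> \<alpha>) E - \<delta> - indicator {..<\<alpha>\<^sub>0} \<alpha>) \<le> measure (mu_alpha P \<rho> \<alpha>) F"
    proof (cases "\<alpha> \<ge> \<alpha>\<^sub>0")
      case True
      with le[OF True] show ?thesis by simp
    next
      case False
      moreover have "measure (mu_alpha P \<rho> \<alpha>) E \<le> 1 + \<delta>"
        using \<delta> A.prob_le_1[of \<alpha> E] by linarith
      ultimately have "c * (measure (mu_alpha P \<rho> \<alpha>) E - \<delta> - indicator {..<\<alpha>\<^sub>0} \<alpha>) \<le> 0"
        using c by (intro mult_nonneg_nonpos) auto
      then show ?thesis by (rule order_trans) simp
    qed
  qed (use int ind in auto)
  finally show ?thesis
    by (simp add: measure_mu_star(2)[OF P F])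
qed

lemma mu_star_weight_event:
  fixes \<rho> :: "real ^ ('d::finite)"
  assumes "prob_space P" "sets P = sets weight_space" "\<rho> \<noteq> 0" "m \<ge> 1" "U \<in> sets weight_space"
  shows "measure (mu_star P \<rho> m) (fst -` U \<inter> space config_space) = measure P U"
proof -
  interpret V: prob_space "uniform_level m" by (rule prob_space_uniform_level) fact
  have E: "fst -` U \<inter> space config_space \<in> sets config_space"
    using assms(5) unfolding config_space_def by (intro measurable_sets[OF measurable_fst])
  have "measure (mu_alpha P \<rho> \<alpha>) (fst -` U \<inter> space config_space) = measure P U" for \<alpha>
  proof -
    have "{t \<in> space P. config_map \<rho> \<alpha> t \<in> fst -` U \<inter> space config_space} = U"
      using measurable_space[OF measurable_config_map_level[OF assms(3,2), of \<alpha>]]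
        sets.sets_into_space[of U P] assms(2,5)
      by (auto simp: config_map_def)
    then show ?thesis
      by (simp add: measure_mu_alpha[OF assms(3,2) E])
  qed
  then show ?thesis
    using V.prob_space by (simp add: measure_mu_star(2)[OF assms(1-4) E])
qed

section \<open>Graph-cylinder events are approximable\<close>

lemma topspace_config_topology: "topspace config_topology = space config_space"
  by (simp add: config_topology_def config_space_def space_pair_measure weight_space_def
      busemann_space_def direction_space_def space_PiM)

lemma continuous_map_weight:
  assumes "e \<in> edges"
  shows "continuous_map config_topology euclideanreal (\<lambda>w. fst w e)"
proof -
  have "continuous_map (product_topology (\<lambda>_. top_of_set {0::real..}) edges) euclideanreal (\<lambda>t. t e)"
    using continuous_map_product_projection[OF assms, of "\<lambda>_. top_of_set {0::real..}"]
    by (simp add: continuous_map_in_subtopology)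
  then have "continuous_map config_topology euclideanreal ((\<lambda>t. t e) \<circ> fst)"
    unfolding config_topology_def by (intro continuous_map_compose[OF continuous_map_fst])
  then show ?thesis by (simp add: o_def)
qed

lemma continuous_map_direction:
  assumes "d \<in> dedges"
  shows "continuous_map config_topology (discrete_topology UNIV) (\<lambda>w. snd (snd w) d)"
proof -
  have "continuous_map config_topology (discrete_topology UNIV) ((\<lambda>\<eta>. \<eta> d) \<circ> (snd \<circ> snd))"
    unfolding config_topology_def
    by (intro continuous_map_compose[OF _ continuous_map_product_projection[OF assms]]
        continuous_map_compose[OF continuous_map_snd] continuous_map_snd)
  then show ?thesis by (simp add: o_def)
qed

definition weight_event :: "('d::finite) weights set \<Rightarrow> 'd config set" where
  "weight_event U = fst -` U \<inter> space config_space"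

lemma weight_event_sets: "U \<in> sets weight_space \<Longrightarrow> weight_event U \<in> sets config_space"
  unfolding weight_event_def config_space_def by (intro measurable_sets[OF measurable_fst])

text \<open>
  The condition \<open>vanish\<close> is continuity at the empty set of the weight marginals, uniformly over the
  family.  It turns finite unions into countable ones.
\<close>

locale equitight_weights =
  fixes MM :: "('d::finite) config measure set"
  assumes MM_prob: "M \<in> MM \<Longrightarrow> prob_space M"
    and MM_sets: "M \<in> MM \<Longrightarrow> sets M = sets config_space"
    and vanish: "\<lbrakk>\<And>i. U i \<in> sets weight_space; decseq U; (\<Inter>i. U i) = {}; \<epsilon> > 0\<rbrakk> \<Longrightarrow>
      \<exists>i::nat. \<forall>M\<in>MM. measure M (weight_event (U i)) \<le> \<epsilon>"
begin

lemma MM_space: "M \<in> MM \<Longrightarrow> space M = space config_space"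
  using sets_eq_imp_space_eq[OF MM_sets] .

lemma approx_empty: "continuity_approx config_topology MM {}"
proof (rule continuity_approx_indicator)
  show "continuous_map config_topology euclideanreal (indicator {} :: 'd config \<Rightarrow> real)"
    by (rule continuous_map_eq[of _ _ "\<lambda>_. 0"]) auto
qed auto

lemma approx_finite_Union:
  assumes "finite F" "\<And>E. E \<in> F \<Longrightarrow> continuity_approx config_topology MM E \<and> E \<subseteq> space config_space"
  shows "continuity_approx config_topology MM (\<Union>F)"
  using assms
proof (induction F)
  case empty
  then show ?case using approx_empty by simp
next
  case (insert E F)
  have "continuity_approx config_topology MM (E \<union> \<Union>F)"
    by (rule continuity_approx_Un[where \<Omega> = "space config_space"])
      (use insert MM_prob MM_space in auto)
  then show ?case by simp
qed

text \<open>
  A ramp of slope \<open>i + 1\<close> starting at \<open>a\<close> differs from the indicator only where the weight lies in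
  \<open>(a, a + 1 / (i + 1))\<close>, and these events decrease to the empty set.
\<close>

lemma approx_weight_greater:
  assumes e: "e \<in> edges"
  shows "continuity_approx config_topology MM (weight_event {t \<in> space weight_space. t e > a})"
    (is "continuity_approx _ _ ?E")
proof -
  note [measurable] = measurable_weight[OF e]
  have sets: "?E \<in> sets M" if "M \<in> MM" for M
    using MM_sets[OF that] by (simp add: weight_event_sets)
  let ?U = "\<lambda>i. {t \<in> space weight_space. a < t e \<and> t e < a + 1 / real (Suc i)}"
  have U: "?U i \<in> sets weight_space" for i by measurable
  have dec: "decseq ?U"
  proof (rule decseq_SucI, rule subsetI)
    fix i t assume t: "t \<in> ?U (Suc i)"
    have "1 / real (Suc (Suc i)) \<le> 1 / real (Suc i)" by (simp add: frac_le)
    with t show "t \<in> ?U i" by force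
  qed
  have empty: "(\<Inter>i. ?U i) = {}"
  proof -
    have False if "\<And>i. t \<in> ?U i" for t
    proof -
      have "t e - a > 0" using that[of 0] by simp
      then obtain i where "1 / real (Suc i) < t e - a"
        using nat_approx_posE by blast
      with that[of i] show False by simp
    qed
    then show ?thesis by blast
  qed
  show ?thesis
    unfolding continuity_approx_def
  proof (intro conjI ballI allI impI sets)
    fix \<epsilon> :: real assume "\<epsilon> > 0"
    from vanish[OF U dec empty this] obtain i
      where i: "\<And>M. M \<in> MM \<Longrightarrow> measure M (weight_event (?U i)) \<le> \<epsilon>"
      by blast
    define f :: "'d config \<Rightarrow> real" where "f w = max 0 (min 1 (real (Suc i) * (fst w e - a)))" for w
    have f: "continuous_map config_topology euclideanreal f"
      unfolding f_def by (intro continuous_intros continuous_map_weight[OF e])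
    have f_meas: "f \<in> borel_measurable config_space"
      unfolding f_def config_space_def by measurable
    have f01: "0 \<le> f w \<and> f w \<le> 1" for w
      by (auto simp: f_def)
    have "(\<integral>w. \<bar>indicator ?E w - f w\<bar> \<partial>M) \<le> \<epsilon>" if M: "M \<in> MM" for M
    proof -
      interpret prob_space M by (rule MM_prob[OF M])
      have fM: "f \<in> borel_measurable M"
        using f_meas MM_sets[OF M] by (simp cong: measurable_cong_sets)
      have UM: "weight_event (?U i) \<in> sets M"
        using weight_event_sets[OF U[of i]] MM_sets[OF M] by simp
      have "(\<integral>w. \<bar>indicator ?E w - f w\<bar> \<partial>M) \<le> (\<integral>w. indicator (weight_event (?U i)) w \<partial>M)"
      proof (rule integral_mono)
        show "integrable M (\<lambda>w. \<bar>indicator ?E w - f w\<bar>)"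
          by (rule integrable_indicator_distance[OF MM_prob[OF M] fM f01 sets[OF M]])
        show "integrable M (indicator (weight_event (?U i)) :: _ \<Rightarrow> real)"
          by (rule integrable_real_indicator[OF UM]) (simp add: emeasure_eq_measure)
        fix w assume "w \<in> space M"
        then have w: "w \<in> space config_space" "fst w \<in> space weight_space"
          by (auto simp: MM_space[OF M] config_space_def space_pair_measure)
        consider "fst w e \<le> a" | "a < fst w e" "fst w e < a + 1 / real (Suc i)"
          | "fst w e \<ge> a + 1 / real (Suc i)"
          by linarith
        then show "\<bar>indicator ?E w - f w\<bar> \<le> (indicator (weight_event (?U i)) w :: real)"
        proof cases
          case 1
          then have "real (Suc i) * (fst w e - a) \<le> 0"
            by (intro mult_nonneg_nonpos) auto
          with 1 show ?thesis
            by (auto simp: f_def weight_event_def indicator_def)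
        next
          case 2
          then have "w \<in> ?E" "w \<in> weight_event (?U i)"
            using w by (auto simp: weight_event_def)
          with f01[of w] show ?thesis by simp
        next
          case 3
          then have "1 \<le> real (Suc i) * (fst w e - a)"
            by (simp add: field_simps)
          moreover have "a < fst w e"
            using 3 by (smt (verit) divide_pos_pos of_nat_0_less_iff zero_less_Suc)
          ultimately show ?thesis
            using 3 w by (auto simp: f_def weight_event_def indicator_def)
        qed
      qed
      also have "\<dots> \<le> \<epsilon>"
        using i[OF M] UM by simp
      finally show ?thesis .
    qed
    moreover have "f \<in> borel_measurable M" if "M \<in> MM" for M
      using f_meas MM_sets[OF that] by (simp cong: measurable_cong_sets)
    ultimately show "\<exists>f. continuous_map config_topology euclideanreal f \<and> (\<forall>x. 0 \<le> f x \<and> f x \<le> 1) \<and>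
        (\<forall>M\<in>MM. f \<in> borel_measurable M \<and> (\<integral>w. \<bar>indicator ?E w - f w\<bar> \<partial>M) \<le> \<epsilon>)"
      using f f01 by blast
  qed
qed

lemma sigma_algebra_approx_weight_events:
  "sigma_algebra (space weight_space)
     {U \<in> sets weight_space. continuity_approx config_topology MM (weight_event U)}"
  unfolding sigma_algebra_iff2
proof (intro conjI ballI allI impI)
  let ?S = "{U \<in> sets weight_space. continuity_approx config_topology MM (weight_event U)}"
  show "?S \<subseteq> Pow (space weight_space)"
    using sets.sets_into_space by auto
  show "{} \<in> ?S"
    using approx_empty by (simp add: weight_event_def)
  show "space weight_space - U \<in> ?S" if "U \<in> ?S" for U
  proof -
    have "weight_event (space weight_space - U) = space config_space - weight_event U"
      by (auto simp: weight_event_def config_space_def space_pair_measure)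
    then show ?thesis
      using that continuity_approx_complement[of config_topology MM "weight_event U"] MM_space by auto
  qed
  fix A :: "nat \<Rightarrow> 'd weights set" assume A: "range A \<subseteq> ?S"
  then have A_sets: "A i \<in> sets weight_space" for i by blast
  let ?D = "\<lambda>i. (\<Union>j. A j) - (\<Union>j<i. A j)"
  have "continuity_approx config_topology MM (weight_event (\<Union>j. A j))"
  proof (rule continuity_approx_limit[OF MM_prob])
    show "weight_event (\<Union>j. A j) \<in> sets M" if "M \<in> MM" for M
      unfolding MM_sets[OF that] using A_sets by (intro weight_event_sets) auto
    fix \<epsilon> :: real assume "\<epsilon> > 0"
    have "decseq ?D"
      by (rule decseq_SucI) (auto simp: less_Suc_eq)
    from vanish[OF _ this _ \<open>\<epsilon> > 0\<close>] A_sets obtain i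
      where i: "\<forall>M\<in>MM. measure M (weight_event (?D i)) \<le> \<epsilon>"
      by (auto simp: sets.Diff sets.countable_UN)
    have "continuity_approx config_topology MM (\<Union>(weight_event ` A ` {..<i}))"
      using A by (intro approx_finite_Union) (auto simp: weight_event_def)
    also have "\<Union>(weight_event ` A ` {..<i}) = weight_event (\<Union>j<i. A j)"
      by (auto simp: weight_event_def)
    finally have "continuity_approx config_topology MM (weight_event (\<Union>j<i. A j))" .
    moreover have "sym_diff (weight_event (\<Union>j. A j)) (weight_event (\<Union>j<i. A j)) = weight_event (?D i)"
      by (auto simp: weight_event_def)
    ultimately show "\<exists>F. continuity_approx config_topology MM F \<and>
        (\<forall>M\<in>MM. measure M (sym_diff (weight_event (\<Union>j. A j)) F) \<le> \<epsilon>)"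
      using i by (intro exI[of _ "weight_event (\<Union>j<i. A j)"]) simp
  qed
  then show "(\<Union>j. A j) \<in> ?S"
    using A_sets by blast
qed

text \<open>
  The approximable weight events form a sigma-algebra for which all coordinates are measurable, so
  they include every measurable set of weights.
\<close>

lemma approx_weight_event:
  assumes "U \<in> sets weight_space"
  shows "continuity_approx config_topology MM (weight_event U)"
proof -
  let ?S = "{U \<in> sets weight_space. continuity_approx config_topology MM (weight_event U)}"
  define N where "N = sigma (space weight_space) ?S"
  have sets_N: "sets N = ?S" and space_N: "space N = space weight_space"
    using sigma_algebra_approx_weight_events
    unfolding N_def by (simp_all add: sigma_algebra.sets_measure_of_eq sigma_algebra.space_measure_of_eq)
  have coord: "(\<lambda>t. t e) \<in> N \<rightarrow>\<^sub>M restrict_space borel {0..}" if e: "e \<in> edges" for e :: "'d edge"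
  proof -
    have "(\<lambda>t. t e) \<in> borel_measurable N"
      unfolding borel_measurable_iff_greater sets_N space_N
      using approx_weight_greater[OF e] measurable_weight[OF e]
      by (auto simp: borel_measurable_iff_greater)
    then show ?thesis
      using weight_nonneg[OF _ e] by (auto simp: measurable_restrict_space2_iff space_N)
  qed
  have "(\<lambda>t e. t e) \<in> N \<rightarrow>\<^sub>M PiM edges (\<lambda>_. restrict_space borel {0..})"
    by (rule measurable_PiM_single'[where f = "\<lambda>e t. t e"])
      (auto simp: space_N space_weight_space intro: coord)
  then have "(\<lambda>t e. t e) \<in> N \<rightarrow>\<^sub>M weight_space"
    by (simp only: weight_space_def[symmetric])
  from measurable_sets[OF this assms] have "(\<lambda>t e. t e) -` U \<inter> space weight_space \<in> ?S"
    unfolding sets_N space_N .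
  then show ?thesis
    using sets.sets_into_space[OF assms] by (simp add: Int_absorb2)
qed

text \<open>
  The direction coordinates are discrete, so these events are clopen.
\<close>

lemma approx_direction_event:
  assumes d: "d \<in> dedges"
  shows "continuity_approx config_topology MM {w \<in> space config_space. snd (snd w) d = a}"
    (is "continuity_approx _ _ ?E")
proof (rule continuity_approx_indicator)
  have "continuous_map config_topology euclideanreal
      ((\<lambda>b. if b = a then 1 else 0 :: real) \<circ> (\<lambda>w. snd (snd w) d))"
    by (rule continuous_map_compose[OF continuous_map_direction[OF d]]) simp
  then show "continuous_map config_topology euclideanreal (indicator ?E :: 'd config \<Rightarrow> real)"
    by (rule continuous_map_eq) (auto simp: topspace_config_topology)
  have "Measurable.pred config_space (\<lambda>w. snd (snd w) d = a)"
  proof -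
    have [measurable]: "(\<lambda>\<eta>. \<eta> d) \<in> direction_space \<rightarrow>\<^sub>M count_space UNIV"
      unfolding direction_space_def using d by (rule measurable_component_singleton)
    show ?thesis
      unfolding config_space_def by measurable
  qed
  then show "?E \<in> sets M" if "M \<in> MM" for M
    by (simp add: MM_sets[OF that] pred_def)
qed

lemma approx_graph_cylinder:
  assumes "graph_cylinder C"
  shows "continuity_approx config_topology MM (lift_event C)"
proof -
  from assms obtain F where F: "finite F" "C = \<Union>F"
    and W: "\<forall>W\<in>F. \<exists>U cs. U \<in> sets weight_space \<and> fst ` set cs \<subseteq> dedges \<and>
           W = U \<times> {\<eta> \<in> space direction_space. \<forall>(e, a)\<in>set cs. \<eta> e = a}"
    unfolding graph_cylinder_def by (elim exE conjE) (rule that)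
  have "continuity_approx config_topology MM (lift_event W)" if "W \<in> F" for W
  proof -
    from bspec[OF W that] obtain U cs where U: "U \<in> sets weight_space" and cs: "fst ` set cs \<subseteq> dedges"
      and eq: "W = U \<times> {\<eta> \<in> space direction_space. \<forall>(e, a)\<in>set cs. \<eta> e = a}"
      by (elim exE conjE) (rule that)
    have "continuity_approx config_topology MM
        (weight_event U \<inter> {w \<in> space config_space. \<forall>(e, a)\<in>set cs. snd (snd w) e = a})"
      using cs
    proof (induction cs)
      case Nil
      have "weight_event U \<inter> space config_space = weight_event U"
        by (auto simp: weight_event_def)
      then show ?case using approx_weight_event[OF U] by simp
    next
      case (Cons c cs)
      obtain d a where c: "c = (d, a)" by fastforce
      with Cons have "continuity_approx config_topology MM
          ((weight_event U \<inter> {w \<in> space config_space. \<forall>(e, a)\<in>set cs. snd (snd w) e = a})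
            \<inter> {w \<in> space config_space. snd (snd w) d = a})"
        by (intro continuity_approx_Int[OF _ approx_direction_event MM_prob]) auto
      also have "\<dots> = weight_event U \<inter> {w \<in> space config_space. \<forall>(e, a)\<in>set (c # cs). snd (snd w) e = a}"
        using c by auto
      finally show ?case .
    qed
    also have "\<dots> = lift_event W"
      by (auto simp: eq lift_event_def weight_event_def config_space_def space_pair_measure)
    finally show ?thesis .
  qed
  then have "continuity_approx config_topology MM (\<Union>(lift_event ` F))"
    using F(1) by (intro approx_finite_Union) (auto simp: lift_event_def)
  also have "\<Union>(lift_event ` F) = lift_event C"
    by (auto simp: lift_event_def F(2))
  finally show ?thesis .
qed

end

section \<open>Raising the weight of one edge\<close>

text \<open>
  The events \<open>X < 1 / (n + 1)\<close> decrease to a null event.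
\<close>

lemma uniform_positivity:
  fixes X :: "'a \<Rightarrow> real"
  assumes "prob_space M" "X \<in> borel_measurable M" "AE x in M. X x > 0" "\<delta> > 0"
  shows "\<exists>c>0. measure M {x \<in> space M. X x < c} \<le> \<delta>"
proof -
  interpret prob_space M by fact
  note [measurable] = assms(2)
  let ?A = "\<lambda>n. {x \<in> space M. X x < 1 / real (Suc n)}"
  have "decseq ?A"
  proof (rule decseq_SucI, rule subsetI)
    fix n x assume x: "x \<in> ?A (Suc n)"
    have "1 / real (Suc (Suc n)) \<le> 1 / real (Suc n)" by (simp add: frac_le)
    with x show "x \<in> ?A n" by force
  qed
  then have "(\<lambda>n. measure M (?A n)) \<longlonglongrightarrow> measure M (\<Inter>n. ?A n)"
    by (intro finite_Lim_measure_decseq) auto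
  moreover have "measure M (\<Inter>n. ?A n) = 0"
  proof -
    have "AE x in M. x \<notin> (\<Inter>n. ?A n)"
      using assms(3)
    proof eventually_elim
      case (elim x)
      then obtain n where "1 / real (Suc n) < X x"
        using nat_approx_posE by blast
      then have "x \<notin> ?A n" by auto
      then show ?case by blast
    qed
    then show ?thesis
      using prob_eq_0[of "\<Inter>n. ?A n"] by auto
  qed
  ultimately have "\<forall>\<^sub>F n in sequentially. measure M (?A n) < \<delta>"
    using order_tendstoD(2)[of _ 0 sequentially \<delta>] assms(4) by simp
  then obtain n where "measure M (?A n) < \<delta>"
    by (auto simp: eventually_sequentially)
  then show ?thesis
    by (intro exI[of _ "1 / real (Suc n)"]) auto
qed

lemma measurable_restrict_others:
  "(\<lambda>t. restrict t (edges - {e})) \<in> weight_space \<rightarrow>\<^sub>M PiM (edges - {e}) (\<lambda>_. restrict_space borel {0..})"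
  unfolding weight_space_def by (rule measurable_restrict_subset) auto

lemma subalgebra_others:
  assumes "sets P = sets weight_space"
  shows "subalgebra P (others_algebra P e)"
proof -
  have "(\<lambda>t. restrict t (edges - {e})) \<in> P \<rightarrow>\<^sub>M PiM (edges - {e}) (\<lambda>_. restrict_space borel {0..})"
    using measurable_restrict_others assms by (simp cong: measurable_cong_sets)
  then show ?thesis
    unfolding subalgebra_def others_algebra_def
    by (intro conjI sets_image_in_sets[OF refl]) simp_all
qed

text \<open>
  The defining property of conditional expectation turns \<open>P(F, t e \<ge> \<kappa>)\<close> into the integral over \<open>F\<close> of
  the conditional probability, which is at least \<open>c\<close> outside an event of probability \<open>\<delta>\<close>.
\<close>

lemma resampling_finite_energy:
  assumes P: "prob_space P" "sets P = sets weight_space" and ufe: "upward_finite_energy P"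
    and e: "e \<in> edges" and \<kappa>: "\<kappa> > 0" and pos: "measure P {t \<in> space P. t e \<ge> \<kappa>} > 0"
    and \<delta>: "\<delta> > 0"
  shows "\<exists>c>0. \<forall>F\<in>sets (others_algebra P e).
    c * (measure P F - \<delta>) \<le> measure P (F \<inter> {t \<in> space P. t e \<ge> \<kappa>})"
proof -
  interpret prob_space P by fact
  let ?G = "others_algebra P e" and ?K = "{t \<in> space P. t e \<ge> \<kappa>}"
  have [measurable]: "(\<lambda>t. t e) \<in> borel_measurable P"
    using measurable_weight[OF e] P(2) by (simp cong: measurable_cong_sets)
  have K: "?K \<in> sets P" by measurable
  note sub = subalgebra_others[OF P(2), of e]
  from sub interpret sigma_finite_subalgebra P ?G
    by (intro finite_measure_subalgebra_is_sigma_finite)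
       (simp add: finite_measure_subalgebra_def finite_measure_axioms finite_measure_subalgebra_axioms_def)
  let ?X = "real_cond_exp P ?G (indicator ?K)"
  have intK: "integrable P (indicator ?K :: _ \<Rightarrow> real)"
    by (rule integrable_real_indicator[OF K]) (simp add: emeasure_eq_measure)
  have AE: "AE t in P. ?X t > 0"
    using ufe e \<kappa> pos unfolding upward_finite_energy_def by blast
  have X: "?X \<in> borel_measurable P" by simp
  have intX: "integrable P ?X"
    by (rule real_cond_exp_int(1)[OF intK])
  from uniform_positivity[OF P(1) X AE \<delta>]
  obtain c where c: "c > 0" "measure P {t \<in> space P. ?X t < c} \<le> \<delta>" by blast
  have "c * (measure P F - \<delta>) \<le> measure P (F \<inter> ?K)" if F: "F \<in> sets ?G" for F
  proof -
    have FP [measurable]: "F \<in> sets P"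
      using sub F by (auto simp: subalgebra_def)
    have S: "{t \<in> space P. ?X t < c} \<in> sets P" by measurable
    have int1: "integrable P (\<lambda>t. indicator F t * ?X t)"
      using integrable_mult_indicator[OF FP intX] by simp
    have "measure P F - \<delta> \<le> measure P F - measure P {t \<in> space P. ?X t < c}"
      using c by simp
    also have "\<dots> \<le> measure P (F - {t \<in> space P. ?X t < c})"
      using finite_measure_mono[of F "(F - {t \<in> space P. ?X t < c}) \<union> {t \<in> space P. ?X t < c}"]
        measure_Un_le[of "F - {t \<in> space P. ?X t < c}" P "{t \<in> space P. ?X t < c}"] S FP by force
    finally have "c * (measure P F - \<delta>) \<le> c * measure P (F - {t \<in> space P. ?X t < c})"
      using c by simp
    also have "\<dots> = (\<integral>t. c * indicator (F - {t \<in> space P. ?X t < c}) t \<partial>P)"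
      using S FP by simp
    also have "\<dots> \<le> (\<integral>t. indicator F t * ?X t \<partial>P)"
    proof (rule integral_mono_AE)
      show "integrable P (\<lambda>t. c * indicator (F - {t \<in> space P. ?X t < c}) t)"
        using S FP by (intro integrable_mult_right integrable_real_indicator)
          (auto simp: emeasure_eq_measure)
      show "AE t in P. c * indicator (F - {t \<in> space P. ?X t < c}) t \<le> indicator F t * ?X t"
        using AE AE_space by eventually_elim (auto simp: indicator_def)
    qed (rule int1)
    also have "\<dots> = (\<integral>t. indicator F t * indicator ?K t \<partial>P)"
      using real_cond_exp_intA[OF intK F] by (simp add: set_lebesgue_integral_def)
    also have "\<dots> = (\<integral>t. indicator (F \<inter> ?K) t \<partial>P)"
      by (simp add: indicator_inter_arith)
    also have "\<dots> = measure P (F \<inter> ?K)"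
      using FP K by simp
    finally show ?thesis .
  qed
  with c show ?thesis by blast
qed

lemma tail_indep_others:
  assumes P: "prob_space P" "sets P = sets weight_space"
    and ind: "prob_space.indep_vars P (\<lambda>_. borel) (\<lambda>e t. t e) edges"
    and e: "e \<in> edges" and F: "F \<in> sets (others_algebra P e)"
  shows "measure P (F \<inter> {t \<in> space P. t e \<ge> \<kappa>}) = measure P F * measure P {t \<in> space P. t e \<ge> \<kappa>}"
proof -
  interpret prob_space P by fact
  let ?r = "\<lambda>J t. restrict t J :: 'a weights"
  let ?O = "edges - {e}"
  have "indep_vars (\<lambda>b. PiM (case_bool {e} ?O b) (\<lambda>_. borel :: real measure))
      (\<lambda>b t. restrict (\<lambda>i. t i) (case_bool {e} ?O b)) UNIV"
    using e by (intro indep_vars_restrict[OF ind]) (auto simp: disjoint_family_on_def split: bool.splits)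
  then have "indep_var (PiM {e} (\<lambda>_. borel :: real measure)) (?r {e}) (PiM ?O (\<lambda>_. borel)) (?r ?O)"
    unfolding indep_var_def by (rule indep_vars_cong[THEN iffD1, rotated -1]) (auto split: bool.splits)
  note indep = indep_varD[OF this]
  have "(\<lambda>t. restrict t ?O) \<in> space P \<rightarrow> space (PiM ?O (\<lambda>_. restrict_space borel {0::real..}))"
    using measurable_space[OF measurable_restrict_others] sets_eq_imp_space_eq[OF P(2)] by auto
  from F[unfolded others_algebra_def sets_vimage_algebra2[OF this]]
  obtain A where A: "A \<in> sets (PiM ?O (\<lambda>_. restrict_space borel {0::real..}))"
    and F_eq: "F = ?r ?O -` A \<inter> space P"
    by blast
  \<comment> \<open>The two product structures on the remaining coordinates differ: one carries nonnegative
    weights only, so events are transported by taking positive parts.\<close>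
  let ?pos = "\<lambda>u. \<lambda>i\<in>?O. max 0 (u i) :: real"
  have "?pos \<in> PiM ?O (\<lambda>_. borel) \<rightarrow>\<^sub>M PiM ?O (\<lambda>_. restrict_space borel {0::real..})"
    by (intro measurable_restrict) (auto simp: measurable_restrict_space2_iff)
  from measurable_sets[OF this A]
  have B: "?pos -` A \<inter> space (PiM ?O (\<lambda>_. borel)) \<in> sets (PiM ?O (\<lambda>_. borel))" (is "?B \<in> _") .
  have pos: "?pos (?r ?O t) = ?r ?O t" if "t \<in> space P" for t
    using weight_nonneg[of t] that sets_eq_imp_space_eq[OF P(2)] by (auto simp: restrict_def max_def)
  have F_eq': "F = ?r ?O -` ?B \<inter> space P"
    unfolding F_eq using pos by (auto simp: space_PiM)
  let ?C = "{u \<in> space (PiM {e} (\<lambda>_. borel :: real measure)). u e \<ge> \<kappa>}"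
  have C: "?C \<in> sets (PiM {e} (\<lambda>_. borel))" by measurable
  have K_eq: "{t \<in> space P. t e \<ge> \<kappa>} = ?r {e} -` ?C \<inter> space P"
    by (auto simp: space_PiM)
  have "F \<inter> {t \<in> space P. t e \<ge> \<kappa>} = (\<lambda>t. (?r {e} t, ?r ?O t)) -` (?C \<times> ?B) \<inter> space P"
    unfolding F_eq' K_eq by auto
  then show ?thesis
    using indep[OF C B] unfolding F_eq'[symmetric] K_eq[symmetric] by simp
qed

lemma resampling:
  assumes P: "prob_space P" "sets P = sets weight_space" "assumption_A P \<or> assumption_B P"
    and e: "e \<in> edges" and \<kappa>: "\<kappa> > 0" and pos: "measure P {t \<in> space P. t e \<ge> \<kappa>} > 0"
    and \<delta>: "\<delta> > 0"
  shows "\<exists>c>0. \<forall>F\<in>sets (others_algebra P e).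
    c * (measure P F - \<delta>) \<le> measure P (F \<inter> {t \<in> space P. t e \<ge> \<kappa>})"
  using P(3)
proof
  assume "assumption_A P"
  then have "prob_space.indep_vars P (\<lambda>_. borel) (\<lambda>e t. t e) edges"
    by (simp add: assumption_A_def)
  note prod = tail_indep_others[OF P(1,2) this e]
  let ?p = "measure P {t \<in> space P. t e \<ge> \<kappa>}"
  have "?p * (measure P F - \<delta>) \<le> measure P F * ?p" for F
    using pos \<delta> by (simp add: algebra_simps)
  then show ?thesis
    using pos by (intro exI[of _ ?p]) (simp add: prod)
next
  assume "assumption_B P"
  then show ?thesis
    using resampling_finite_energy[OF P(1,2) _ e \<kappa> pos \<delta>] by (simp add: assumption_B_def)
qed

definition increasing_in_edge :: "('d::finite) edge \<Rightarrow> 'd weights set \<Rightarrow> bool" where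
  "increasing_in_edge e D \<longleftrightarrow>
     (\<forall>t\<in>D. \<forall>t'\<in>space weight_space. t e \<le> t' e \<and> (\<forall>f\<in>edges - {e}. t' f = t f) \<longrightarrow> t' \<in> D)"

text \<open>
  With \<open>K\<close> the event \<open>t e \<ge> \<kappa>\<close> and \<open>F\<close> the event \<open>t(e := \<kappa>) \<in> D\<close>, monotonicity gives
  \<open>F \<inter> K \<subseteq> D \<inter> K\<close> and \<open>D \<subseteq> (D \<inter> K) \<union> F\<close>.  Combining the resampling bound for \<open>F\<close> with
  \<open>P(F) \<ge> P(D) - P(D \<inter> K)\<close> and solving for \<open>P(D \<inter> K)\<close> replaces the constant \<open>c\<close> by \<open>c / (1 + c)\<close>.
\<close>

lemma resampling_increasing:
  assumes P: "prob_space P" "sets P = sets weight_space" "assumption_A P \<or> assumption_B P"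
    and e: "e \<in> edges" and \<kappa>: "\<kappa> > 0" and pos: "measure P {t \<in> space P. t e \<ge> \<kappa>} > 0"
    and \<delta>: "\<delta> > 0"
  shows "\<exists>c>0. \<forall>D\<in>sets P. increasing_in_edge e D \<longrightarrow>
    c * (measure P D - \<delta>) \<le> measure P (D \<inter> {t \<in> space P. t e \<ge> \<kappa>})"
proof -
  interpret prob_space P by fact
  let ?K = "{t \<in> space P. t e \<ge> \<kappa>}" and ?O = "edges - {e}"
  note space_P = sets_eq_imp_space_eq[OF P(2)]
  have "(\<lambda>t. t e) \<in> borel_measurable P"
    using measurable_weight[OF e] P(2) by (simp cong: measurable_cong_sets)
  then have K: "?K \<in> sets P" by measurable
  from resampling[OF P e \<kappa> pos \<delta>] obtain c where c: "c > 0"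
    and res: "\<And>F. F \<in> sets (others_algebra P e) \<Longrightarrow> c * (measure P F - \<delta>) \<le> measure P (F \<inter> ?K)"
    by blast
  have "c / (1 + c) * (measure P D - \<delta>) \<le> measure P (D \<inter> ?K)"
    if D: "D \<in> sets P" and incr: "increasing_in_edge e D" for D
  proof -
    have mono: "t' \<in> D" if "t \<in> D" "t' \<in> space P" "t e \<le> t' e" "\<forall>f\<in>?O. t' f = t f" for t t'
      using incr that unfolding increasing_in_edge_def space_P by blast
    \<comment> \<open>Overwriting the weight of \<open>e\<close> as a function of the other weights alone makes \<open>F\<close> an event
      of their sigma-algebra.\<close>
    define set_e where "set_e u = (\<lambda>f\<in>edges. if f = e then \<kappa> else u f :: real)" for u
    define F where "F = (\<lambda>t. restrict t ?O) -` (set_e -` D \<inter> space (PiM ?O (\<lambda>_. restrict_space borel {0..}))) \<inter> space P"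
    have "set_e \<in> PiM ?O (\<lambda>_. restrict_space borel {0..}) \<rightarrow>\<^sub>M weight_space"
      unfolding weight_space_def set_e_def
    proof (rule measurable_restrict)
      fix f :: "'a edge" assume f: "f \<in> edges"
      show "(\<lambda>u. if f = e then \<kappa> else u f) \<in> PiM ?O (\<lambda>_. restrict_space borel {0..}) \<rightarrow>\<^sub>M restrict_space borel {0..}"
        using \<kappa> f by (cases "f = e") (auto simp: measurable_restrict_space2_iff[of "\<lambda>_. \<kappa>"])
    qed
    from measurable_sets[OF this] D P(2) have F_others: "F \<in> sets (others_algebra P e)"
      unfolding F_def others_algebra_def by (intro in_vimage_algebra) simp
    then have F: "F \<in> sets P"
      using subalgebra_others[OF P(2), of e] by (auto simp: subalgebra_def)
    note res = res[OF F_others]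
    have F_iff: "t \<in> F \<longleftrightarrow> t(e := \<kappa>) \<in> D" if t: "t \<in> space P" for t
    proof -
      have "restrict t ?O \<in> space (PiM ?O (\<lambda>_. restrict_space borel {0..}))"
        using measurable_space[OF measurable_restrict_others] t space_P by auto
      moreover have "set_e (restrict t ?O) = t(e := \<kappa>)"
        using t e unfolding space_P space_weight_space set_e_def
        by (auto simp: fun_eq_iff PiE_iff extensional_def)
      ultimately show ?thesis
        using t by (simp add: F_def)
    qed
    have upd: "t(e := \<kappa>) \<in> space P" if "t \<in> space P" for t
      using that e \<kappa> unfolding space_P space_weight_space by (auto simp: PiE_iff extensional_def)
    have "F \<inter> ?K \<subseteq> D \<inter> ?K"
    proof
      fix t assume t: "t \<in> F \<inter> ?K"
      then have "t \<in> D"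
        using mono[of "t(e := \<kappa>)" t] F_iff upd by auto
      with t show "t \<in> D \<inter> ?K" by blast
    qed
    then have "measure P (F \<inter> ?K) \<le> measure P (D \<inter> ?K)"
      using D K by (intro finite_measure_mono) auto
    with res have 1: "c * (measure P F - \<delta>) \<le> measure P (D \<inter> ?K)" by linarith
    have "D \<subseteq> (D \<inter> ?K) \<union> F"
    proof
      fix t assume t: "t \<in> D"
      then have "t \<in> space P" using D sets.sets_into_space by auto
      with t show "t \<in> (D \<inter> ?K) \<union> F"
        using mono[of t "t(e := \<kappa>)"] F_iff upd by (cases "t e \<ge> \<kappa>") auto
    qed
    then have "measure P D \<le> measure P (D \<inter> ?K \<union> F)"
      using D K F by (intro finite_measure_mono) auto
    also have "\<dots> \<le> measure P (D \<inter> ?K) + measure P F"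
      using D K F by (intro measure_Un_le) auto
    finally have "c * (measure P D - measure P (D \<inter> ?K) - \<delta>) \<le> c * (measure P F - \<delta>)"
      using c by (intro mult_left_mono) auto
    with 1 have "c * (measure P D - \<delta>) \<le> (1 + c) * measure P (D \<inter> ?K)"
      by (simp add: algebra_simps)
    then show ?thesis
      using c by (simp add: field_simps)
  qed
  moreover have "c / (1 + c) > 0"
    using c by simp
  ultimately show ?thesis by blast
qed

section \<open>All edges have the same weight distribution\<close>

lemma edge_is_unit_step:
  assumes "e \<in> edges"
  obtains x :: "('d::finite) vertex" and i where "e = {x, x + axis i 1}"
proof -
  from assms obtain x y where e: "e = {x, y}" and adj: "(\<Sum>i\<in>UNIV. \<bar>x $ i - y $ i\<bar>) = 1"
    by (auto simp: edges_def adjacent_def)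
  then obtain i where i: "x $ i \<noteq> y $ i"
    by force
  have "\<bar>x $ i - y $ i\<bar> + (\<Sum>k\<in>UNIV - {i}. \<bar>x $ k - y $ k\<bar>) = 1"
    using adj by (simp add: sum.remove[of UNIV i])
  moreover have "(\<Sum>k\<in>UNIV - {i}. \<bar>x $ k - y $ k\<bar>) \<ge> 0"
    by (simp add: sum_nonneg)
  ultimately have one: "\<bar>x $ i - y $ i\<bar> = 1" and "(\<Sum>k\<in>UNIV - {i}. \<bar>x $ k - y $ k\<bar>) = 0"
    using i by linarith+
  then have others: "x $ k = y $ k" if "k \<noteq> i" for k
    using that by (simp add: sum_nonneg_eq_0_iff)
  from one consider "y $ i = x $ i + 1" | "x $ i = y $ i + 1" by linarith
  then have "y = x + axis i 1 \<or> x = y + axis i 1"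
    using others by cases (auto simp: vec_eq_iff axis_def)
  then show ?thesis
    using that e by (metis insert_commute)
qed

text \<open>
  The symmetry is a translation composed with the swap of the two coordinate directions of the edges.
\<close>

lemma edge_transitive:
  assumes "e \<in> edges" "f \<in> edges"
  obtains \<phi> :: "('d::finite) vertex \<Rightarrow> 'd vertex" where "lattice_symmetry \<phi>" "\<phi> ` e = f"
proof -
  obtain a i where e: "e = {a, a + axis i 1}" using edge_is_unit_step[OF assms(1)] .
  obtain b j where f: "f = {b, b + axis j 1}" using edge_is_unit_step[OF assms(2)] .
  define \<tau> where "\<tau> = Transposition.transpose i j"
  have \<tau>: "\<tau> (\<tau> k) = k" for k by (simp add: \<tau>_def)
  have bij_\<tau>: "bij \<tau>" by (simp add: \<tau>_def)
  define \<phi> :: "'d vertex \<Rightarrow> 'd vertex" where "\<phi> v = b + (\<chi> k. (v - a) $ \<tau> k)" for v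
  have "bij \<phi>"
    by (rule o_bij[of "\<lambda>v. a + (\<chi> k. (v - b) $ \<tau> k)"]) (auto simp: \<phi>_def fun_eq_iff vec_eq_iff \<tau>)
  moreover have "adjacent (\<phi> x) (\<phi> y) \<longleftrightarrow> adjacent x y" for x y
  proof -
    have "(\<Sum>k\<in>UNIV. \<bar>\<phi> x $ k - \<phi> y $ k\<bar>) = (\<Sum>k\<in>UNIV. \<bar>x $ \<tau> k - y $ \<tau> k\<bar>)"
      by (simp add: \<phi>_def)
    also have "\<dots> = (\<Sum>k\<in>UNIV. \<bar>x $ k - y $ k\<bar>)"
      by (rule sum.reindex_bij_betw[OF bij_\<tau>])
    finally show ?thesis by (simp add: adjacent_def)
  qed
  ultimately have "lattice_symmetry \<phi>"
    by (simp add: lattice_symmetry_def)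
  moreover have "\<phi> ` e = f"
  proof -
    have "\<phi> a = b" by (simp add: \<phi>_def vec_eq_iff)
    moreover have "\<phi> (a + axis i 1) = b + axis j 1"
      by (auto simp: \<phi>_def vec_eq_iff axis_def \<tau>_def Transposition.transpose_def)
    ultimately show ?thesis by (simp add: e f)
  qed
  ultimately show ?thesis by (rule that)
qed

lemma lattice_symmetry_edge:
  assumes "lattice_symmetry \<phi>" "e \<in> edges"
  shows "\<phi> ` e \<in> edges"
  using assms unfolding lattice_symmetry_def edges_def by fastforce

lemma measurable_relabel:
  assumes "lattice_symmetry \<phi>"
  shows "relabel \<phi> \<in> weight_space \<rightarrow>\<^sub>M weight_space"
proof -
  have "(\<lambda>t. \<lambda>e\<in>edges. t (\<phi> ` e)) \<in> weight_space \<rightarrow>\<^sub>M PiM edges (\<lambda>_. restrict_space borel {0::real..})"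
    unfolding weight_space_def
    by (intro measurable_restrict measurable_component_singleton lattice_symmetry_edge[OF assms])
  then show ?thesis
    by (simp add: weight_space_def[symmetric] relabel_def[abs_def])
qed

text \<open>
  The supremum of the weights is formed at \<open>e\<close> and used at \<open>e\<^sub>0\<close>.  Equal marginals are part of
  assumption A; under assumption B a lattice symmetry carries one edge to the other.
\<close>

lemma weight_tail_edge_invariant:
  assumes P: "prob_space P" "sets P = sets weight_space" "assumption_A P \<or> assumption_B P"
    and e: "e \<in> edges" and f: "f \<in> edges"
  shows "measure P {t \<in> space P. t f \<ge> x} = measure P {t \<in> space P. t e \<ge> x}"
  using P(3)
proof
  have meas: "(\<lambda>t. t g) \<in> borel_measurable P" if "g \<in> edges" for g
    using measurable_weight[OF that] P(2) by (simp cong: measurable_cong_sets)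
  have tail: "measure (distr P borel (\<lambda>t. t g)) {x..} = measure P {t \<in> space P. t g \<ge> x}"
    if "g \<in> edges" for g
    by (subst measure_distr[OF meas[OF that]]) (auto intro!: arg_cong[of _ _ "measure P"])
  assume "assumption_A P"
  then have "distr P borel (\<lambda>t. t f) = distr P borel (\<lambda>t. t e)"
    using e f unfolding assumption_A_def by blast
  then show ?thesis
    by (simp add: tail[symmetric] e f)
next
  assume B: "assumption_B P"
  obtain \<phi> where \<phi>: "lattice_symmetry \<phi>" "\<phi> ` f = e"
    using edge_transitive[OF f e] .
  note space_P = sets_eq_imp_space_eq[OF P(2)]
  have meas: "relabel \<phi> \<in> P \<rightarrow>\<^sub>M weight_space"
    using measurable_relabel[OF \<phi>(1)] P(2) by (simp cong: measurable_cong_sets)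
  have sets: "{t \<in> space P. t f \<ge> x} \<in> sets weight_space"
    unfolding space_P using measurable_weight[OF f] by measurable
  have "distr P weight_space (relabel \<phi>) = P"
    using B \<phi>(1) by (simp add: assumption_B_def has_lattice_symmetries_def)
  then have "measure P {t \<in> space P. t f \<ge> x} = measure (distr P weight_space (relabel \<phi>)) {t \<in> space P. t f \<ge> x}"
    by simp
  also have "\<dots> = measure P (relabel \<phi> -` {t \<in> space P. t f \<ge> x} \<inter> space P)"
    by (rule measure_distr[OF meas sets])
  also have "relabel \<phi> -` {t \<in> space P. t f \<ge> x} \<inter> space P = {t \<in> space P. t e \<ge> x}"
    using measurable_space[OF meas] f \<phi>(2) by (auto simp: space_P relabel_def)
  finally show ?thesis .
qed

section \<open>Modifying an edge weight under a geodesic measure\<close>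

text \<open>
  All averaged measures have weight marginal \<open>P\<close>, so the family has only two weight marginals
  to control, that of \<open>\<mu>\<close> and \<open>P\<close> itself.
\<close>

lemma geodesic_measure_equitight:
  fixes \<rho> :: "real ^ ('d::finite)"
  assumes P: "prob_space P" "sets P = sets weight_space" "\<rho> \<noteq> 0" and \<mu>: "geodesic_measure P \<rho> \<mu>"
  shows "equitight_weights (insert \<mu> (mu_star P \<rho> ` {1..}))"
proof (rule equitight_weights.intro)
  interpret P: prob_space P by fact
  interpret \<mu>: prob_space \<mu> using \<mu> by (simp add: geodesic_measure_def)
  have sets_\<mu>: "sets \<mu> = sets config_space" using \<mu> by (simp add: geodesic_measure_def)
  show "prob_space M" if "M \<in> insert \<mu> (mu_star P \<rho> ` {1..})" for M
    using that prob_space_mu_star[OF P] \<mu>.prob_space_axioms by auto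
  show "sets M = sets config_space" if "M \<in> insert \<mu> (mu_star P \<rho> ` {1..})" for M
    using that by (elim insertE imageE) (simp_all only: sets_\<mu> sets_mu_star)
  fix U :: "nat \<Rightarrow> 'd weights set" and \<epsilon> :: real
  assume U: "\<And>i. U i \<in> sets weight_space" "decseq U" "(\<Inter>i. U i) = {}" and "\<epsilon> > 0"
  have "(\<lambda>i. measure P (U i)) \<longlonglongrightarrow> measure P (\<Inter>i. U i)"
    by (rule P.finite_Lim_measure_decseq[OF _ U(2)]) (simp add: image_subset_iff U(1) P(2))
  then have lim_P: "(\<lambda>i. measure P (U i)) \<longlonglongrightarrow> 0"
    using U(3) by simp
  have "(\<lambda>i. measure \<mu> (weight_event (U i))) \<longlonglongrightarrow> measure \<mu> (\<Inter>i. weight_event (U i))"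
  proof (rule \<mu>.finite_Lim_measure_decseq)
    show "range (\<lambda>i. weight_event (U i)) \<subseteq> sets \<mu>"
      unfolding sets_\<mu> by (intro image_subsetI weight_event_sets U(1))
    show "decseq (\<lambda>i. weight_event (U i))"
      using U(2) unfolding decseq_def weight_event_def by blast
  qed
  moreover have "(\<Inter>i. weight_event (U i)) = {}"
    using U(3) by (auto simp: weight_event_def)
  ultimately have "(\<lambda>i. measure \<mu> (weight_event (U i))) \<longlonglongrightarrow> 0"
    by simp
  from eventually_conj[OF order_tendstoD(2)[OF lim_P \<open>\<epsilon> > 0\<close>] order_tendstoD(2)[OF this \<open>\<epsilon> > 0\<close>]]
  obtain i where i: "measure P (U i) < \<epsilon>" "measure \<mu> (weight_event (U i)) < \<epsilon>"
    by (auto simp: eventually_sequentially)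
  have "measure (mu_star P \<rho> m) (weight_event (U i)) = measure P (U i)" if "m \<ge> 1" for m
    unfolding weight_event_def by (rule mu_star_weight_event[OF P that U(1)])
  with i have "\<forall>M\<in>insert \<mu> (mu_star P \<rho> ` {1..}). measure M (weight_event (U i)) \<le> \<epsilon>"
    by (simp add: less_imp_le)
  then show "\<exists>i. \<forall>M\<in>insert \<mu> (mu_star P \<rho> ` {1..}). measure M (weight_event (U i)) \<le> \<epsilon>" ..
qed

lemma geodesic_measure_limit:
  fixes \<rho> :: "real ^ ('d::finite)"
  assumes P: "prob_space P" "sets P = sets weight_space" "\<rho> \<noteq> 0" and \<mu>: "geodesic_measure P \<rho> \<mu>"
  obtains k :: "nat \<Rightarrow> nat" where "strict_mono k"
    "\<And>E. continuity_approx config_topology (insert \<mu> (mu_star P \<rho> ` {1..})) E \<Longrightarrow>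
      (\<lambda>n. measure (mu_star P \<rho> (k n)) E) \<longlonglongrightarrow> measure \<mu> E"
proof -
  interpret equitight_weights "insert \<mu> (mu_star P \<rho> ` {1..})"
    by (rule geodesic_measure_equitight[OF assms])
  from \<mu> obtain k where k: "strict_mono k"
    "converges_weakly config_topology (\<lambda>n. mu_star P \<rho> (k n)) \<mu>"
    unfolding geodesic_measure_def by blast
  have "\<forall>\<^sub>F n in sequentially. mu_star P \<rho> (k n) \<in> insert \<mu> (mu_star P \<rho> ` {1..})"
    using eventually_ge_at_top[of 1]
  proof eventually_elim
    case (elim n)
    then have "k n \<ge> 1" using seq_suble[OF k(1), of n] by linarith
    then show ?case by auto
  qed
  with k show ?thesis
    by (intro that[of k] continuity_approx_convergence[OF _ MM_prob]) auto
qed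

text \<open>
  The measures along the subsequence give this event the constant probability \<open>P(U)\<close>, and its
  probabilities converge.
\<close>

lemma geodesic_measure_weight_event:
  fixes \<rho> :: "real ^ ('d::finite)"
  assumes P: "prob_space P" "sets P = sets weight_space" "\<rho> \<noteq> 0" and \<mu>: "geodesic_measure P \<rho> \<mu>"
    and U: "U \<in> sets weight_space"
  shows "measure \<mu> (weight_event U) = measure P U"
proof -
  interpret equitight_weights "insert \<mu> (mu_star P \<rho> ` {1..})"
    by (rule geodesic_measure_equitight[OF P \<mu>])
  obtain k where k: "strict_mono k"
    and lim: "\<And>E. continuity_approx config_topology (insert \<mu> (mu_star P \<rho> ` {1..})) E \<Longrightarrow>
      (\<lambda>n. measure (mu_star P \<rho> (k n)) E) \<longlonglongrightarrow> measure \<mu> E"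
    by (rule geodesic_measure_limit[OF P \<mu>]) (rule that)
  have "\<forall>\<^sub>F n in sequentially. measure (mu_star P \<rho> (k n)) (weight_event U) = measure P U"
    using eventually_ge_at_top[of 1]
  proof eventually_elim
    case (elim n)
    then have "k n \<ge> 1" using seq_suble[OF k(1), of n] by linarith
    then show ?case
      unfolding weight_event_def by (rule mu_star_weight_event[OF P _ U])
  qed
  then have "(\<lambda>n. measure (mu_star P \<rho> (k n)) (weight_event U)) \<longlonglongrightarrow> measure P U"
    by (rule tendsto_eventually)
  from LIMSEQ_unique[OF lim[OF approx_weight_event[OF U]] this] show ?thesis .
qed

lemma lift_event_sets:
  assumes "A \<in> sets (weight_space \<Otimes>\<^sub>M direction_space)"
  shows "lift_event A \<in> sets config_space"
proof -
  have "(\<lambda>w. (fst w, snd (snd w))) \<in> config_space \<rightarrow>\<^sub>M weight_space \<Otimes>\<^sub>M direction_space"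
    unfolding config_space_def by measurable
  from measurable_sets[OF this assms]
  have "(\<lambda>w. (fst w, snd (snd w))) -` A \<inter> space config_space \<in> sets config_space" .
  also have "(\<lambda>w. (fst w, snd (snd w))) -` A \<inter> space config_space = lift_event A"
    by (auto simp: lift_event_def)
  finally show ?thesis .
qed

text \<open>
  At each level \<open>\<alpha> \<ge> \<alpha>\<^sub>0\<close> the weights that \<open>\<Phi>\<^sub>\<alpha>\<close> sends into \<open>C\<close> form an event that is
  increasing in the edge; both cylinder probabilities converge along the subsequence, and the
  contribution of the levels below \<open>\<alpha>\<^sub>0\<close> vanishes.
\<close>

lemma increasing_cylinder_bound:
  fixes \<rho> :: "real ^ ('d::finite)"
  assumes P: "prob_space P" "sets P = sets weight_space" "\<rho> \<noteq> 0" and \<mu>: "geodesic_measure P \<rho> \<mu>"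
    and C: "graph_cylinder C" and K: "K \<in> sets weight_space" and c: "c > 0" and \<delta>: "\<delta> > 0"
    and resample: "\<forall>D\<in>sets P. increasing_in_edge e D \<longrightarrow>
      c * (measure P D - \<delta>) \<le> measure P (D \<inter> K)"
    and mono: "\<forall>\<alpha>\<ge>\<alpha>\<^sub>0. \<forall>t\<in>space weight_space. \<forall>t'\<in>space weight_space.
           t' e \<ge> t e \<and> (\<forall>f\<in>edges - {e}. t' f = t f) \<longrightarrow>
           (t, direction \<rho> \<alpha> t) \<in> C \<longrightarrow> (t', direction \<rho> \<alpha> t') \<in> C"
  shows "c * (measure \<mu> (lift_event C) - \<delta>) \<le> measure \<mu> (lift_event C \<inter> weight_event K)"
proof -
  interpret equitight_weights "insert \<mu> (mu_star P \<rho> ` {1..})"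
    by (rule geodesic_measure_equitight[OF P \<mu>])
  obtain k where k: "strict_mono k"
    and lim: "\<And>E. continuity_approx config_topology (insert \<mu> (mu_star P \<rho> ` {1..})) E \<Longrightarrow>
      (\<lambda>n. measure (mu_star P \<rho> (k n)) E) \<longlonglongrightarrow> measure \<mu> E"
    by (rule geodesic_measure_limit[OF P \<mu>]) (rule that)
  let ?E = "lift_event C" and ?F = "lift_event C \<inter> weight_event K" and ?\<alpha> = "max 0 \<alpha>\<^sub>0"
  note space_P = sets_eq_imp_space_eq[OF P(2)]
  have approx_E: "continuity_approx config_topology (insert \<mu> (mu_star P \<rho> ` {1..})) ?E"
    by (rule approx_graph_cylinder[OF C])
  have approx_F: "continuity_approx config_topology (insert \<mu> (mu_star P \<rho> ` {1..})) ?F"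
    by (intro continuity_approx_Int[OF approx_E approx_weight_event[OF K] MM_prob])
  have E: "?E \<in> sets config_space" and F: "?F \<in> sets config_space"
    using continuity_approx_sets[OF approx_E, of \<mu>] continuity_approx_sets[OF approx_F, of \<mu>] MM_sets[of \<mu>]
    by auto
  have level: "c * (measure (mu_alpha P \<rho> \<alpha>) ?E - \<delta>) \<le> measure (mu_alpha P \<rho> \<alpha>) ?F" if \<alpha>: "\<alpha> \<ge> ?\<alpha>" for \<alpha>
  proof -
    let ?D = "{t \<in> space P. config_map \<rho> \<alpha> t \<in> ?E}"
    have D_iff: "t \<in> ?D \<longleftrightarrow> (t, direction \<rho> \<alpha> t) \<in> C" if "t \<in> space P" for t
      using that measurable_space[OF measurable_config_map_level[OF P(3,2)] that, of \<alpha>]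
      by (auto simp: lift_event_def config_map_def)
    have D: "?D \<in> sets P"
      using measurable_sets[OF measurable_config_map_level[OF P(3,2)] E, of \<alpha>]
      by (simp add: vimage_def Int_def conj_commute)
    have "increasing_in_edge e ?D"
      unfolding increasing_in_edge_def
    proof (intro ballI impI)
      fix t t' assume t: "t \<in> ?D" and t': "t' \<in> space weight_space"
        and raised: "t e \<le> t' e \<and> (\<forall>f\<in>edges - {e}. t' f = t f)"
      from t have tP: "t \<in> space P" by simp
      with t have "(t, direction \<rho> \<alpha> t) \<in> C"
        using D_iff by blast
      then have "(t', direction \<rho> \<alpha> t') \<in> C"
        using mono \<alpha> tP t' raised unfolding space_P by auto
      then show "t' \<in> ?D"
        using D_iff t' unfolding space_P by blast
    qed
    with resample D have "c * (measure P ?D - \<delta>) \<le> measure P (?D \<inter> K)" by blast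
    also have "?D \<inter> K = {t \<in> space P. config_map \<rho> \<alpha> t \<in> ?F}"
      using measurable_space[OF measurable_config_map_level[OF P(3,2)], of _ \<alpha>]
      by (auto simp: weight_event_def config_map_def)
    finally show ?thesis
      by (simp add: measure_mu_alpha[OF P(3,2) E] measure_mu_alpha[OF P(3,2) F])
  qed
  have averaged: "\<forall>\<^sub>F n in sequentially.
      c * (measure (mu_star P \<rho> (k n)) ?E - \<delta> - ?\<alpha> / real (k n)) \<le> measure (mu_star P \<rho> (k n)) ?F"
    using eventually_ge_at_top[of 1]
  proof eventually_elim
    case (elim n)
    then have "k n \<ge> 1" using seq_suble[OF k, of n] by linarith
    then show ?case
      using c \<delta> by (intro mu_star_lower_bound[OF P _ E F] level) auto
  qed
  have "filterlim k at_top sequentially"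
    using k by (rule filterlim_subseq)
  then have "filterlim (\<lambda>n. real (k n)) at_top sequentially"
    by (rule filterlim_compose[OF filterlim_real_sequentially])
  then have "(\<lambda>n. ?\<alpha> / real (k n)) \<longlonglongrightarrow> 0"
    by (rule real_tendsto_divide_at_top[OF tendsto_const])
  then have "(\<lambda>n. c * (measure (mu_star P \<rho> (k n)) ?E - \<delta> - ?\<alpha> / real (k n)))
      \<longlonglongrightarrow> c * (measure \<mu> ?E - \<delta> - 0)"
    by (intro tendsto_intros lim approx_E)
  from tendsto_le[OF _ lim[OF approx_F] this averaged] show ?thesis by simp
qed

text \<open>
  The constants \<open>c\<close> and \<open>\<delta>\<close> do not depend on the approximating cylinder, whose level \<open>\<alpha>\<^sub>0\<close> has already
  disappeared, so the approximation can be refined with the constants fixed.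
\<close>

lemma approximable_bound:
  fixes \<rho> :: "real ^ ('d::finite)"
  assumes P: "prob_space P" "sets P = sets weight_space" "\<rho> \<noteq> 0" and \<mu>: "geodesic_measure P \<rho> \<mu>"
    and A: "approximable \<rho> \<mu> e A" and K: "K \<in> sets weight_space" and c: "c > 0" and \<delta>: "\<delta> > 0"
    and resample: "\<forall>D\<in>sets P. increasing_in_edge e D \<longrightarrow>
      c * (measure P D - \<delta>) \<le> measure P (D \<inter> K)"
  shows "c * (measure \<mu> (lift_event A) - \<delta>) \<le> measure \<mu> (lift_event A \<inter> weight_event K)"
proof -
  interpret \<mu>: prob_space \<mu> using \<mu> by (simp add: geodesic_measure_def)
  interpret equitight_weights "insert \<mu> (mu_star P \<rho> ` {1..})"
    by (rule geodesic_measure_equitight[OF P \<mu>])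
  have sets_\<mu>: "sets \<mu> = sets config_space" using \<mu> by (simp add: geodesic_measure_def)
  from A obtain C where A_sets: "A \<in> sets (weight_space \<Otimes>\<^sub>M direction_space)"
    and C: "\<forall>n. graph_cylinder (C n)"
    and diff: "(\<lambda>n. measure \<mu> (sym_diff (lift_event (C n)) (lift_event A))) \<longlonglongrightarrow> 0"
    and mono: "\<forall>n. \<exists>\<alpha>\<^sub>0::real. \<forall>\<alpha>\<ge>\<alpha>\<^sub>0. \<forall>t\<in>space weight_space. \<forall>t'\<in>space weight_space.
           t' e \<ge> t e \<and> (\<forall>f\<in>edges - {e}. t' f = t f) \<longrightarrow>
           (t, direction \<rho> \<alpha> t) \<in> C n \<longrightarrow> (t', direction \<rho> \<alpha> t') \<in> C n"
    unfolding approximable_def by (elim exE conjE) (rule that)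
  note C = C[rule_format]
  have LA: "lift_event A \<in> sets \<mu>"
    using lift_event_sets[OF A_sets] sets_\<mu> by simp
  have LC: "lift_event (C n) \<in> sets \<mu>" for n
    using continuity_approx_sets[OF approx_graph_cylinder[OF C]] by blast
  have KW: "weight_event K \<in> sets \<mu>"
    using weight_event_sets[OF K] sets_\<mu> by simp
  let ?d = "\<lambda>n. measure \<mu> (sym_diff (lift_event (C n)) (lift_event A))"
  have "c * (measure \<mu> (lift_event A) - ?d n - \<delta>) \<le> measure \<mu> (lift_event A \<inter> weight_event K) + ?d n" for n
  proof -
    have S: "sym_diff (lift_event (C n)) (lift_event A) \<in> sets \<mu>"
      using LA LC by blast
    have "measure \<mu> (lift_event A) \<le> measure \<mu> (lift_event (C n) \<union> sym_diff (lift_event (C n)) (lift_event A))"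
      using LA LC S by (intro \<mu>.finite_measure_mono) auto
    also have "\<dots> \<le> measure \<mu> (lift_event (C n)) + ?d n"
      using LC S by (intro measure_Un_le) auto
    finally have "c * (measure \<mu> (lift_event A) - ?d n - \<delta>) \<le> c * (measure \<mu> (lift_event (C n)) - \<delta>)"
      using c by (intro mult_left_mono) auto
    also have "\<dots> \<le> measure \<mu> (lift_event (C n) \<inter> weight_event K)"
    proof -
      from spec[OF mono, of n] obtain \<alpha>\<^sub>0 where "\<forall>\<alpha>\<ge>\<alpha>\<^sub>0. \<forall>t\<in>space weight_space. \<forall>t'\<in>space weight_space.
           t' e \<ge> t e \<and> (\<forall>f\<in>edges - {e}. t' f = t f) \<longrightarrow>
           (t, direction \<rho> \<alpha> t) \<in> C n \<longrightarrow> (t', direction \<rho> \<alpha> t') \<in> C n" ..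
      from increasing_cylinder_bound[OF P \<mu> C K c \<delta> resample this] show ?thesis .
    qed
    also have "\<dots> \<le> measure \<mu> (lift_event A \<inter> weight_event K \<union> sym_diff (lift_event (C n)) (lift_event A))"
      using LA KW S by (intro \<mu>.finite_measure_mono) auto
    also have "\<dots> \<le> measure \<mu> (lift_event A \<inter> weight_event K) + ?d n"
      using LA KW S by (intro measure_Un_le) auto
    finally show ?thesis .
  qed
  note le = this
  have "(\<lambda>n. c * (measure \<mu> (lift_event A) - ?d n - \<delta>)) \<longlonglongrightarrow> c * (measure \<mu> (lift_event A) - 0 - \<delta>)"
    by (intro tendsto_intros diff)
  moreover have "(\<lambda>n. measure \<mu> (lift_event A \<inter> weight_event K) + ?d n)
      \<longlonglongrightarrow> measure \<mu> (lift_event A \<inter> weight_event K) + 0"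
    by (intro tendsto_intros diff)
  ultimately have "c * (measure \<mu> (lift_event A) - 0 - \<delta>) \<le> measure \<mu> (lift_event A \<inter> weight_event K) + 0"
    by (rule LIMSEQ_le) (use le in blast)
  then show ?thesis by simp
qed

theorem theoremA1:
  fixes P :: "('d::finite) weights measure"
    and \<mu> :: "'d config measure"
    and H :: "(real ^ 'd) set" and z\<^sub>0 \<rho> :: "real ^ 'd"
    and e e\<^sub>0 :: "'d edge"
    and \<kappa> r :: real
  assumes "CARD('d) \<ge> 2"
    and "prob_space P" and "sets P = sets weight_space"
    and "assumption_A P \<or> assumption_B P"
    and "supporting_hyperplane (limit_shape P) H z\<^sub>0"
    and "H = {z. z \<bullet> \<rho> = 1}"
    and "geodesic_measure P \<rho> \<mu>"
    and "e \<in> edges" and "e\<^sub>0 \<in> edges"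
    and "0 \<le> \<kappa>" and "ereal \<kappa> < weight_sup \<mu> e"
    and "r > 0"
  shows "\<exists>s>0. \<forall>A. approximable \<rho> \<mu> e\<^sub>0 A \<and> measure \<mu> (lift_event A) \<ge> r \<longrightarrow>
           measure \<mu> (lift_event A \<inter> {w \<in> space \<mu>. fst w e\<^sub>0 \<ge> \<kappa>}) \<ge> s"
proof -
  interpret \<mu>: prob_space \<mu> using assms(7) by (simp add: geodesic_measure_def)
  have sets_\<mu>: "sets \<mu> = sets config_space" using assms(7) by (simp add: geodesic_measure_def)
  note space_\<mu> = sets_eq_imp_space_eq[OF sets_\<mu>] and space_P = sets_eq_imp_space_eq[OF assms(3)]
  have "z\<^sub>0 \<bullet> \<rho> = 1"
    using assms(5,6) by (simp add: supporting_hyperplane_def)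
  then have \<rho>: "\<rho> \<noteq> 0" by auto
  note P = assms(2,3) \<rho>
  have tail_sets: "{t \<in> space weight_space. t f \<ge> x} \<in> sets weight_space" if "f \<in> edges" for f x
    using measurable_weight[OF that] by measurable
  have tail_event: "weight_event {t \<in> space weight_space. t f \<ge> x} = {w \<in> space \<mu>. fst w f \<ge> x}" for f x
    by (auto simp: weight_event_def space_\<mu> config_space_def space_pair_measure)
  \<comment> \<open>The finite-energy hypothesis concerns positive thresholds, so \<open>\<kappa>\<close> is replaced by a
    larger one that is still reached with positive probability.\<close>
  from assms(11) obtain x where x: "x > \<kappa>" "measure \<mu> {w \<in> space \<mu>. fst w e \<ge> x} > 0"
    unfolding weight_sup_def less_Sup_iff by auto
  have "measure P {t \<in> space P. t e \<ge> x} > 0"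
    using x(2) geodesic_measure_weight_event[OF P assms(7) tail_sets[OF assms(8)], of x]
    by (simp add: tail_event space_P)
  then have pos: "measure P {t \<in> space P. t e\<^sub>0 \<ge> x} > 0"
    using weight_tail_edge_invariant[OF assms(2-4,8,9)] by simp
  have "x > 0" "r / 2 > 0" using x(1) assms(10,12) by auto
  from resampling_increasing[OF assms(2-4,9) this(1) pos this(2)] obtain c where c: "c > 0"
    and res: "\<forall>D\<in>sets P. increasing_in_edge e\<^sub>0 D \<longrightarrow>
      c * (measure P D - r / 2) \<le> measure P (D \<inter> {t \<in> space P. t e\<^sub>0 \<ge> x})"
    by blast
  show ?thesis
  proof (intro exI[of _ "c * (r / 2)"] conjI allI impI)
    show "c * (r / 2) > 0" using c assms(12) by simp
    fix A assume "approximable \<rho> \<mu> e\<^sub>0 A \<and> measure \<mu> (lift_event A) \<ge> r"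
    then have A: "approximable \<rho> \<mu> e\<^sub>0 A" and r: "measure \<mu> (lift_event A) \<ge> r" by auto
    have "c * (r / 2) \<le> c * (measure \<mu> (lift_event A) - r / 2)"
      using c r by (intro mult_left_mono) auto
    also have "\<dots> \<le> measure \<mu> (lift_event A \<inter> weight_event {t \<in> space weight_space. t e\<^sub>0 \<ge> x})"
      using approximable_bound[OF P assms(7) A tail_sets[OF assms(9)] c \<open>r / 2 > 0\<close> res[unfolded space_P]] .
    also have "\<dots> \<le> measure \<mu> (lift_event A \<inter> {w \<in> space \<mu>. fst w e\<^sub>0 \<ge> \<kappa>})"
    proof -
      have lift: "lift_event A \<in> sets \<mu>"
        using A lift_event_sets[of A] unfolding approximable_def sets_\<mu> by blast
      have "{w \<in> space \<mu>. fst w e\<^sub>0 \<ge> \<kappa>} \<in> sets \<mu>"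
        using weight_event_sets[OF tail_sets[OF assms(9)], of \<kappa>] unfolding tail_event sets_\<mu> .
      then show ?thesis
        unfolding tail_event using x(1) lift by (intro \<mu>.finite_measure_mono) auto
    qed
    finally show "c * (r / 2) \<le> measure \<mu> (lift_event A \<inter> {w \<in> space \<mu>. fst w e\<^sub>0 \<ge> \<kappa>})" .
  qed
qed

end
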